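(* Let $G=\mathrm{SO}(2,n)$ with $n\ge3$, realized as in the context, let $\rho(g)=g\wedge g$ on $\mathbb{R}^{n+2}\wedge\mathbb{R}^{n+2}$, and let $H$ be a closed, connected subgroup of $N$ with Lie algebra $\mathfrak h$. (1) If $\dim H\le1$, then either $\rho(h)\asymp h$ for $h\in H$, or $\rho(h)\asymp\|h\|^{3/2}$ for $h\in H$, or $\rho(h)\asymp\|h\|^2$ for $h\in H$. (2) If for every nonzero element of $\mathfrak h$ we have $\phi=0$ and $\dim\langle x,y\rangle\neq1$, then $\rho(h)\asymp\|h\|^2$ for $h\in H$. (3) If for every nonzero element of $\mathfrak h$ we have $\phi=0$ and $\dim\langle x,y\rangle=1$, then $\rho(h)\asymp h$ for $h\in H$. (4) If there exist a subspace $X_0$ of $\mathbb{R}^{n-2}$, $b\in X_0$, $c\in X_0^\perp$, and $p\in\mathbb{R}$ with $\|b\|^2-\|c\|^2-2p<0$, such that for every element of $\mathfrak h$ we have $y=0$, $x\in\phi c+X_0$, and $\eta=p\phi+b\cdot x$, then $\rho(h)\asymp h$ for $h\in H$.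
   Context: $\mathrm{SO}(2,n)$ is the group of determinant-one linear isometries of the quadratic form $\langle v\mid v\rangle=2v_1v_{n+2}+2v_2v_{n+1}+\sum_{i=3}^n v_i^2$ on $\mathbb{R}^{n+2}$. $N$ is the group of upper-triangular matrices in $\mathrm{SO}(2,n)$ with all diagonal entries $1$. Its Lie algebra $\mathfrak n$ consists of the matrices (block sizes $1,1,n-2,1,1$) $$\begin{pmatrix}0&\phi&x&\eta&0\\0&0&y&0&-\eta\\0&0&0&-y^T&-x^T\\0&0&0&0&-\phi\\0&0&0&0&0\end{pmatrix},\qquad \phi,\eta\in\mathbb{R},\ x,y\in\mathbb{R}^{n-2}\text{ (row vectors)},$$ so each element of $\mathfrak n$ determines values of $\phi,x,y,\eta$. $\langle x,y\rangle$ denotes the linear span of $x,y$ in $\mathbb{R}^{n-2}$; dot product, norm and $X_0^\perp$ in $\mathbb{R}^{n-2}$ are Euclidean. Matrix norms are any fixed norms. For $k>0$, $\rho(h)\asymp\|h\|^k$ for $h\in H$ means there is a constant $c\ge1$ with $c^{-1}\|h\|^k\le\|\rho(h)\|\le c\|h\|^k$ for all sufficiently large $h\in H$ (outside a compact set); $\rho(h)\asymp h$ is the case $k=1$. *)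

theory Defs
  imports "HOL-Analysis.Analysis" "HOL-Algebra.Group"
begin

text \<open>
  The coordinates of $\mathbb{R}^{n+2}$ are indexed by a type that shows the block sizes
  $1,1,n-2,1,1$. The middle coordinates $3,\dots,n$ are \<open>Mid i\<close> for \<open>i\<close> in a finite linearly
  ordered type \<open>'k\<close>, so that \<open>n = CARD('k) + 2\<close>. Types are nonempty, hence \<open>n \<ge> 3\<close>; and every
  \<open>n \<ge> 3\<close> occurs.
\<close>

datatype 'k idx = First | Second | Mid 'k | Penult | Last

lemma UNIV_idx: "(UNIV :: 'k idx set) = {First, Second, Penult, Last} \<union> range Mid"
  by (auto intro: idx.exhaust)

instance idx :: (finite) finite
  by standard (simp add: UNIV_idx)

lemma CARD_idx: "CARD('k::finite idx) = CARD('k) + 4"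
proof -
  have "card (range (Mid :: 'k \<Rightarrow> 'k idx)) = CARD('k)"
    by (simp add: card_image inj_on_def)
  then show ?thesis
    unfolding UNIV_idx by (subst card_Un_disjoint) auto
qed

fun idx_block :: "'k idx \<Rightarrow> nat" where
  "idx_block First = 1"
| "idx_block Second = 2"
| "idx_block (Mid _) = 3"
| "idx_block Penult = 4"
| "idx_block Last = 5"

instantiation idx :: (linorder) linorder
begin

definition less_eq_idx :: "'a idx \<Rightarrow> 'a idx \<Rightarrow> bool" where
  "i \<le> j \<longleftrightarrow> (case (i, j) of (Mid a, Mid b) \<Rightarrow> a \<le> b | _ \<Rightarrow> idx_block i \<le> idx_block j)"

definition less_idx :: "'a idx \<Rightarrow> 'a idx \<Rightarrow> bool" where
  "i < j \<longleftrightarrow> i \<le> j \<and> \<not> j \<le> (i :: 'a idx)"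

instance
proof
  fix i j k :: "'a idx"
  show "i < j \<longleftrightarrow> i \<le> j \<and> \<not> j \<le> i"
    by (simp add: less_idx_def)
  show "i \<le> i"
    by (cases i) (auto simp: less_eq_idx_def)
  show "i \<le> k" if "i \<le> j" "j \<le> k"
    using that by (cases i; cases j; cases k) (auto simp: less_eq_idx_def)
  show "i = j" if "i \<le> j" "j \<le> i"
    using that by (cases i; cases j) (auto simp: less_eq_idx_def)
  show "i \<le> j \<or> j \<le> i"
    by (cases i; cases j) (auto simp: less_eq_idx_def)
qed

end

type_synonym 'k vector = "real ^ 'k idx"
type_synonym 'k matrix = "real ^ 'k idx ^ 'k idx"

definition quad_form :: "'k::finite vector \<Rightarrow> real" where
  "quad_form v = 2 * v $ First * v $ Last + 2 * v $ Second * v $ Penult + (\<Sum>i\<in>UNIV. (v $ Mid i)\<^sup>2)"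

definition SO2 :: "'k::finite matrix set" where
  "SO2 = {g. det g = 1 \<and> (\<forall>v. quad_form (g *v v) = quad_form v)}"

definition N_set :: "'k::{finite,linorder} matrix set" where
  "N_set = {g \<in> SO2. (\<forall>i j. j < i \<longrightarrow> g $ i $ j = 0) \<and> (\<forall>i. g $ i $ i = 1)}"

definition N_group :: "'k::{finite,linorder} matrix monoid" where
  "N_group = \<lparr>carrier = N_set, mult = (**), one = mat 1\<rparr>"

text \<open>
  The library's \<open>exp\<close> and \<open>*\<close> do not refer to the matrix product (\<open>*\<close> is componentwise on
  vectors), so the matrix exponential is defined by its power series.
\<close>

definition mat_exp :: "real ^ 'm::finite ^ 'm \<Rightarrow> real ^ 'm ^ 'm" where
  "mat_exp A = (\<Sum>k. (1 / fact k) *\<^sub>R ((**) A ^^ k) (mat 1))"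

definition lie_algebra :: "(real ^ 'm::finite ^ 'm) set \<Rightarrow> (real ^ 'm ^ 'm) set" where
  "lie_algebra H = {A. \<forall>t::real. mat_exp (t *\<^sub>R A) \<in> H}"

text \<open>
  The Lie algebra of $N$ consists of the matrices \<open>nil_mat \<phi> x y \<eta>\<close>; the coordinate functions
  below read off the four parameters.
\<close>

definition nil_mat ::
  "real \<Rightarrow> real ^ 'k \<Rightarrow> real ^ 'k \<Rightarrow> real \<Rightarrow> 'k::finite matrix" where
  "nil_mat \<phi> x y \<eta> = (\<chi> i j. case (i, j) of
     (First, Second) \<Rightarrow> \<phi>  | (First, Mid b) \<Rightarrow> x $ b | (First, Penult) \<Rightarrow> \<eta>
   | (Second, Mid b) \<Rightarrow> y $ b | (Second, Last) \<Rightarrow> - \<eta>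
   | (Mid a, Penult) \<Rightarrow> - y $ a | (Mid a, Last) \<Rightarrow> - x $ a
   | (Penult, Last) \<Rightarrow> - \<phi>
   | _ \<Rightarrow> 0)"

definition phi_of :: "'k::finite matrix \<Rightarrow> real" where
  "phi_of A = A $ First $ Second"

definition x_of :: "'k::finite matrix \<Rightarrow> real ^ 'k" where
  "x_of A = (\<chi> i. A $ First $ Mid i)"

definition y_of :: "'k::finite matrix \<Rightarrow> real ^ 'k" where
  "y_of A = (\<chi> i. A $ Second $ Mid i)"

definition eta_of :: "'k::finite matrix \<Rightarrow> real" where
  "eta_of A = A $ First $ Penult"

lemma nil_mat_coords [simp]:
  "phi_of (nil_mat \<phi> x y \<eta>) = \<phi>" "x_of (nil_mat \<phi> x y \<eta>) = x"
  "y_of (nil_mat \<phi> x y \<eta>) = y" "eta_of (nil_mat \<phi> x y \<eta>) = \<eta>"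
  by (simp_all add: nil_mat_def phi_of_def x_of_def y_of_def eta_of_def vec_eq_iff)

text \<open>
  $\mathbb{R}^{n+2}\wedge\mathbb{R}^{n+2}$ is the coordinate space of the basis $e_i\wedge e_j$,
  $i<j$ (see \<open>wedge_axis\<close>), and \<open>rho g\<close> is the matrix of $g\wedge g$ in this basis: its column
  $(k,l)$ is $g e_k\wedge g e_l$.
\<close>

typedef (overloaded) ('k::linorder) wedge_idx = "{p :: 'k idx \<times> 'k idx. fst p < snd p}"
  by (rule exI[of _ "(First, Second)"]) (simp add: less_idx_def less_eq_idx_def)

instance wedge_idx :: ("{finite,linorder}") finite
proof
  show "finite (UNIV :: 'a wedge_idx set)"
    by (rule finite_imageD[of Rep_wedge_idx]) (auto simp: inj_on_def Rep_wedge_idx_inject)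
qed

abbreviation row_idx :: "'k::linorder wedge_idx \<Rightarrow> 'k idx" where
  "row_idx p \<equiv> fst (Rep_wedge_idx p)"

abbreviation col_idx :: "'k::linorder wedge_idx \<Rightarrow> 'k idx" where
  "col_idx p \<equiv> snd (Rep_wedge_idx p)"

definition wedge ::
  "'k::{finite,linorder} vector \<Rightarrow> 'k vector \<Rightarrow> real ^ 'k wedge_idx" where
  "wedge v w = (\<chi> p. v $ row_idx p * w $ col_idx p - v $ col_idx p * w $ row_idx p)"

definition rho ::
  "'k::{finite,linorder} matrix \<Rightarrow> real ^ 'k wedge_idx ^ 'k wedge_idx" where
  "rho g = (\<chi> p q. wedge (g *v axis (row_idx q) 1) (g *v axis (col_idx q) 1) $ p)"

lemma wedge_axis: "wedge (axis (row_idx q) 1) (axis (col_idx q) 1) = axis q 1"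
proof -
  have "row_idx p < col_idx p" for p :: "'a wedge_idx"
    using Rep_wedge_idx[of p] by simp
  moreover have "p = q \<longleftrightarrow> row_idx p = row_idx q \<and> col_idx p = col_idx q" for p
    by (simp add: Rep_wedge_idx_inject[symmetric] prod_eq_iff)
  ultimately show ?thesis
    by (auto simp: wedge_def axis_def vec_eq_iff) (metis less_asym)+
qed

lemma rho_wedge:
  fixes g :: "'k::{finite,linorder} matrix"
  shows "rho g *v wedge v w = wedge (g *v v) (g *v w)"
proof (rule vec_eq_iff[THEN iffD2], rule allI)
  fix p :: "'k wedge_idx"
  let ?a = "row_idx p" and ?b = "col_idx p"
  define T where "T k l = g $ ?a $ k * g $ ?b $ l * (v $ k * w $ l - v $ l * w $ k)" for k l
  have ax: "(g *v axis k 1) $ i = g $ i $ k" for i k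
    by (simp add: matrix_vector_mult_basis column_def)
  have entry: "rho g $ p $ q = g $ ?a $ row_idx q * g $ ?b $ col_idx q
      - g $ ?b $ row_idx q * g $ ?a $ col_idx q" for q
    by (simp add: rho_def wedge_def ax)
  have inj: "inj (Rep_wedge_idx :: 'k wedge_idx \<Rightarrow> _)"
    by (simp add: inj_on_def Rep_wedge_idx_inject)
  have ran: "range (Rep_wedge_idx :: 'k wedge_idx \<Rightarrow> _) = {(k, l). k < l}"
    using type_definition.Rep_range[OF type_definition_wedge_idx] by (simp add: case_prod_beta')
  have "(rho g *v wedge v w) $ p
      = (\<Sum>q\<in>UNIV. (\<lambda>(k, l). T k l + T l k) (Rep_wedge_idx q))"
    by (simp add: matrix_vector_mult_def entry wedge_def T_def case_prod_beta algebra_simps)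
  also have "\<dots> = (\<Sum>(k, l) | k < l. T k l + T l k)"
    using sum.reindex[OF inj, of "\<lambda>(k, l). T k l + T l k"] ran by (simp add: case_prod_beta o_def)
  also have "\<dots> = (\<Sum>(k, l) | k < l. T k l) + (\<Sum>(k, l) | k < l. T l k)"
    by (simp add: sum.distrib case_prod_beta)
  also have "(\<Sum>(k, l) | k < l. T l k) = (\<Sum>(k, l) | l < k. T k l)"
    by (rule sum.reindex_bij_witness[of _ prod.swap prod.swap]) auto
  also have "(\<Sum>(k, l) | k < l. T k l) + (\<Sum>(k, l) | l < k. T k l) = (\<Sum>(k, l)\<in>UNIV. T k l)"
  proof -
    have "(\<Sum>(k, l)\<in>UNIV. T k l) = (\<Sum>(k, l)\<in>{(k, l). k < l} \<union> {(k, l). l < k}. T k l)"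
      by (rule sum.mono_neutral_right) (auto simp: T_def not_less_iff_gr_or_eq)
    also have "\<dots> = (\<Sum>(k, l) | k < l. T k l) + (\<Sum>(k, l) | l < k. T k l)"
      by (rule sum.union_disjoint) auto
    finally show ?thesis by simp
  qed
  also have "\<dots> = (\<Sum>k\<in>UNIV. \<Sum>l\<in>UNIV. T k l)"
    by (simp add: sum.cartesian_product)
  also have "\<dots> = (\<Sum>k\<in>UNIV. \<Sum>l\<in>UNIV. (g $ ?a $ k * v $ k) * (g $ ?b $ l * w $ l))
      - (\<Sum>k\<in>UNIV. \<Sum>l\<in>UNIV. (g $ ?a $ k * w $ k) * (g $ ?b $ l * v $ l))"
    by (simp add: T_def sum_subtractf algebra_simps)
  also have "\<dots> = (g *v v) $ ?a * (g *v w) $ ?b - (g *v w) $ ?a * (g *v v) $ ?b"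
    by (simp add: matrix_vector_mult_def sum_product)
  finally show "(rho g *v wedge v w) $ p = wedge (g *v v) (g *v w) $ p"
    by (simp add: wedge_def mult.commute)
qed

definition is_norm :: "('v::real_vector \<Rightarrow> real) \<Rightarrow> bool" where
  "is_norm \<nu> \<longleftrightarrow> (\<forall>v. \<nu> v \<ge> 0) \<and> (\<forall>v. \<nu> v = 0 \<longleftrightarrow> v = 0) \<and>
     (\<forall>c v. \<nu> (c *\<^sub>R v) = \<bar>c\<bar> * \<nu> v) \<and> (\<forall>v w. \<nu> (v + w) \<le> \<nu> v + \<nu> w)"

definition rho_asymp ::
  "('k matrix \<Rightarrow> real) \<Rightarrow> (real ^ 'k wedge_idx ^ 'k wedge_idx \<Rightarrow> real) \<Rightarrow>
   'k::{finite,linorder} matrix set \<Rightarrow> real \<Rightarrow> bool" where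
  "rho_asymp \<nu> \<nu>' H k \<longleftrightarrow> (\<exists>c\<ge>1. \<exists>K. compact K \<and> K \<subseteq> H \<and>
     (\<forall>h \<in> H - K. \<nu> h powr k / c \<le> \<nu>' (rho h) \<and> \<nu>' (rho h) \<le> c * \<nu> h powr k))"

end

theory Submission
  imports Defs
begin

text \<open>
  In the coordinates \<open>(\<phi>, x, y, \<eta>)\<close>, the exponential map identifies \<open>N\<close> with a vector space whose
  product is the Baker-Campbell-Hausdorff formula of a Lie algebra of nilpotency class 3. A closed
  connected subgroup \<open>H\<close> becomes a linear subspace \<open>S\<close>, so \<open>H\<close> is the exponential of its Lie algebra,
  and all entries of \<open>h\<close> and of \<open>\<rho>(h)\<close> (the $2\times 2$ minors of \<open>h\<close>) are explicit polynomials on \<open>S\<close>.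
  Their growth is compared by homogeneity and compactness. If \<open>\<phi> = 0\<close>, the upper right minor is
  $-\eta^2$ minus a quarter of the Gram determinant of $x,y$, which is quartic unless $x$ and $y$ are
  proportional. If $y = 0$, or if \<open>\<phi> = 0\<close> and $x,y$ are proportional, all minors are at most quadratic.
  For a line with $\phi \ne 0$ and $y \ne 0$, a grading of the coordinates gives the degrees $4$ and $6$.
\<close>

section \<open>Connected closed subgroups in Baker-Campbell-Hausdorff coordinates\<close>

text \<open>Compactness arguments on a unit sphere need a set that is stable under scaling, and a
  closed connected set stable under the group product has no evident such property. The closed
  subgroup theorem is therefore proved first, directly for this product: nilpotency makes the
  product polynomial, so its behaviour under rescaling is explicit. The exponent depends on a race
  between entries and minors. Exponent 1 needs genuinely quadratic entries and a cancellation of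
  everything above degree 2 in the minors. The first requirement is positivity of a quadratic form
  on \<open>S\<close>: this is phi * eta + |x|^2 / 2 if y = 0, and |x|^2 + |y|^2 if phi = 0 and x, y
  are proportional. The inequality for p in claim (4) is what makes the former positive. Exponent 2
  arises in two ways: quartic minors against quadratic entries, or quadratic minors against linear
  entries, the latter when these forms degenerate. Exponent 3/2 is the quotient 6/4.\<close>

text \<open>The Baker-Campbell-Hausdorff series without the brackets of four or more elements.\<close>

definition bch :: "('v \<Rightarrow> 'v \<Rightarrow> 'v) \<Rightarrow> 'v \<Rightarrow> 'v \<Rightarrow> 'v::real_vector" where
  "bch b u v = u + v + (1/2) *\<^sub>R b u v + (1/12) *\<^sub>R b u (b u v) - (1/12) *\<^sub>R b v (b u v)"

text \<open>By \<open>class3\<close> every bracket of four elements is zero, so the truncated series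
  is the whole series. Associativity stands in for the Jacobi identity because it can be inherited
  from matrix multiplication.\<close>

locale bch_group = bounded_bilinear b
  for b :: "'v::euclidean_space \<Rightarrow> 'v \<Rightarrow> 'v" +
  assumes alt: "b u u = 0"
    and class3: "b u (b v (b w z)) = 0"
    and assoc: "bch b (bch b u v) w = bch b u (bch b v w)"
begin

abbreviation star (infixl "\<star>" 70) where "u \<star> v \<equiv> bch b u v"

lemma anti: "b u v = - b v u"
proof -
  have "b (u + v) (u + v) = 0" by (rule alt)
  then show ?thesis using alt[of u] alt[of v] by (simp add: add_left add_right add_eq_0_iff2)
qed

lemma star_scaleR: "(s *\<^sub>R v) \<star> (t *\<^sub>R v) = (s + t) *\<^sub>R v"
  by (simp add: bch_def scaleR_left scaleR_right alt zero_right scaleR_add_left)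

lemma star_uminus_right [simp]: "v \<star> (- v) = 0"
  using star_scaleR[of 1 v "-1"] by simp

lemma star_uminus_left [simp]: "(- v) \<star> v = 0"
  using star_scaleR[of "-1" v 1] by simp

lemma star_zero [simp]: "0 \<star> v = v" "v \<star> 0 = v"
  by (simp_all add: bch_def zero_left zero_right)

lemma continuous_on_star [continuous_intros]:
  "continuous_on A f \<Longrightarrow> continuous_on A g \<Longrightarrow> continuous_on A (\<lambda>x. f x \<star> g x)"
  unfolding bch_def by (intro continuous_intros continuous_on)

text \<open>This is Ad(exp u) = exp(ad u), where the series stops because the cube of ad u is zero.
  Conjugation is thus linear in \<open>v\<close>.\<close>

lemma star_conj: "(u \<star> v) \<star> (- u) = v + b u v + (1/2) *\<^sub>R b u (b u v)"
proof -
  define c where "c = b u v"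
  have c: "b v u = - c" unfolding c_def by (rule anti)
  have cu: "b c u = - b u c" by (rule anti)
  have zz: "b w (b z c) = 0" for w z by (simp add: c_def class3)
  have zc: "b (b w c) z = 0" for w z using anti[of "b w c" z] zz[of z w] by simp
  have e1: "u \<star> v = u + v + (1/2) *\<^sub>R c + (1/12) *\<^sub>R b u c - (1/12) *\<^sub>R b v c"
    by (simp add: bch_def c_def)
  have e2: "b (u \<star> v) (- u) = c + (1/2) *\<^sub>R b u c"
    unfolding e1 by (simp add: add_left diff_left scaleR_left minus_right c alt zc cu)
  have e3: "b (u \<star> v) (c + (1/2) *\<^sub>R b u c) = b u c + b v c"
    unfolding e1 by (simp add: add_left diff_left scaleR_left add_right scaleR_right alt zz zc)
  have e4: "b u (c + (1/2) *\<^sub>R b u c) = b u c"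
    by (simp add: add_right scaleR_right zz)
  have "(u \<star> v) \<star> (- u) = u \<star> v + - u + (1/2) *\<^sub>R (c + (1/2) *\<^sub>R b u c)
      + (1/12) *\<^sub>R (b u c + b v c) + (1/12) *\<^sub>R b u c"
    unfolding bch_def[of b "u \<star> v" "- u"] e2 e3 minus_left e4 by simp
  \<comment> \<open>The terms \<open>b v c\<close> from \<open>e1\<close> and \<open>e3\<close>
    cancel. The four coefficients of \<open>b u c\<close> come from \<open>e1\<close>, from half of
    the half in \<open>e2\<close>, from \<open>e3\<close> and from \<open>e4\<close>.\<close>
  also have "\<dots> = v + (1/2 + 1/2) *\<^sub>R c + (1/12 + 1/4 + 1/12 + 1/12) *\<^sub>R b u c"
    unfolding e1 by (simp only: scaleR_add_left) (simp add: scaleR_add_right)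
  finally show ?thesis by (simp add: c_def)
qed

text \<open>At scale s the brackets have order s^2 or smaller, so after division by s only the sum
  survives.\<close>

lemma tendsto_star_rescaled:
  assumes s: "s \<longlonglongrightarrow> 0" "\<And>k. s k \<noteq> 0" and U: "U \<longlonglongrightarrow> u" and W: "W \<longlonglongrightarrow> w"
  shows "(\<lambda>k. (1 / s k) *\<^sub>R ((s k *\<^sub>R U k) \<star> (s k *\<^sub>R W k))) \<longlonglongrightarrow> u + w"
proof -
  have "(1 / s k) *\<^sub>R ((s k *\<^sub>R U k) \<star> (s k *\<^sub>R W k)) = U k + W k + (s k / 2) *\<^sub>R b (U k) (W k)
      + (s k * s k / 12) *\<^sub>R b (U k) (b (U k) (W k)) - (s k * s k / 12) *\<^sub>R b (W k) (b (U k) (W k))" for k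
    using s(2)[of k]
    by (simp add: bch_def scaleR_left scaleR_right scaleR_add_right scaleR_diff_right)
  moreover have "(\<lambda>k. U k + W k + (s k / 2) *\<^sub>R b (U k) (W k)
      + (s k * s k / 12) *\<^sub>R b (U k) (b (U k) (W k)) - (s k * s k / 12) *\<^sub>R b (W k) (b (U k) (W k)))
    \<longlonglongrightarrow> u + w + (0 / 2) *\<^sub>R b u w + (0 * 0 / 12) *\<^sub>R b u (b u w) - (0 * 0 / 12) *\<^sub>R b w (b u w)"
    by (intro tendsto_intros tendsto U W s(1)) simp_all
  ultimately show ?thesis by simp
qed

section \<open>Closed subgroups and their one-parameter subgroups\<close>

context
  fixes S :: "'v set"
  assumes closed_S: "closed S" and zero_S: "0 \<in> S"
    and star_S: "\<And>u v. u \<in> S \<Longrightarrow> v \<in> S \<Longrightarrow> u \<star> v \<in> S"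
    and uminus_S: "\<And>u. u \<in> S \<Longrightarrow> - u \<in> S"
begin

lemma of_nat_S: "v \<in> S \<Longrightarrow> of_nat n *\<^sub>R v \<in> S"
proof (induction n)
  case 0 then show ?case using zero_S by simp
next
  case (Suc n)
  then have "(of_nat n *\<^sub>R v) \<star> (1 *\<^sub>R v) \<in> S" by (intro star_S) auto
  then show ?case by (simp only: star_scaleR) (simp add: add.commute)
qed

lemma of_int_S: "v \<in> S \<Longrightarrow> of_int n *\<^sub>R v \<in> S"
  using of_nat_S[of v "nat n"] uminus_S[OF of_nat_S[of v "nat (- n)"]]
  by (cases "n \<ge> 0") auto

text \<open>Integer multiples are powers in the group, hence stay in \<open>S\<close>. As the step
  lengths \<open>norm (m k)\<close> tend to 0, such multiples reach every point of the limiting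
  line, and \<open>S\<close> is closed.\<close>

lemma limit_direction_S:
  assumes m: "\<And>k. m k \<in> S" "\<And>k. m k \<noteq> 0" "m \<longlonglongrightarrow> 0"
    and B: "(\<lambda>k. m k /\<^sub>R norm (m k)) \<longlonglongrightarrow> B"
  shows "t *\<^sub>R B \<in> S"
proof -
  define n where "n k = \<lfloor>t / norm (m k)\<rfloor>" for k
  have "norm (of_int (n k) * norm (m k) - t) \<le> norm (m k)" for k
  proof -
    have "norm (m k) > 0" using m(2) by simp
    moreover have "of_int (n k) \<le> t / norm (m k)" "t / norm (m k) < of_int (n k) + 1"
      unfolding n_def by linarith+
    ultimately show ?thesis by (simp add: field_simps abs_le_iff)
  qed
  then have "(\<lambda>k. of_int (n k) * norm (m k) - t) \<longlonglongrightarrow> 0"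
    by (intro Lim_null_comparison[OF _ tendsto_norm_zero[OF m(3)]] always_eventually) blast
  then have "(\<lambda>k. of_int (n k) * norm (m k)) \<longlonglongrightarrow> t"
    by (simp add: LIM_zero_iff)
  from tendsto_scaleR[OF this B] have lim: "(\<lambda>k. of_int (n k) *\<^sub>R m k) \<longlonglongrightarrow> t *\<^sub>R B"
    using m(2) by (simp add: mult.assoc)
  show ?thesis
    by (rule closed_sequentially[OF closed_S _ lim]) (rule of_int_S[OF m(1)])
qed

text \<open>The Lie algebra of \<open>S\<close>: in exponential coordinates the one-parameter
  subgroups are the straight lines through 0.\<close>

definition lines where "lines = {v. \<forall>t. t *\<^sub>R v \<in> S}"

lemma lines_subset: "lines \<subseteq> S"
  unfolding lines_def by (auto dest: spec[of _ 1])

lemma lines_scaleR: "v \<in> lines \<Longrightarrow> t *\<^sub>R v \<in> lines"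
  by (simp add: lines_def)

text \<open>Trotter's product formula: high powers of a product of two short steps converge to the
  sum.\<close>

lemma lines_add:
  assumes "u \<in> lines" "v \<in> lines" shows "u + v \<in> lines"
proof -
  have "t *\<^sub>R (u + v) \<in> S" for t
  proof -
    \<comment> \<open>With this choice \<open>1 / s k\<close> is the integer \<open>Suc k\<close>,
      so the rescaled product is a power of an element of \<open>S\<close>.\<close>
    define s where "s k = 1 / (1 + real k)" for k
    have s: "s \<longlonglongrightarrow> 0" unfolding s_def
      using LIMSEQ_inverse_real_of_nat by (simp add: inverse_eq_divide)
    have lim: "(\<lambda>k. (1 / s k) *\<^sub>R ((s k *\<^sub>R t *\<^sub>R u) \<star> (s k *\<^sub>R t *\<^sub>R v))) \<longlonglongrightarrow> t *\<^sub>R u + t *\<^sub>R v"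
      by (rule tendsto_star_rescaled[OF s _ tendsto_const tendsto_const]) (simp add: s_def)
    have mem: "(1 / s k) *\<^sub>R ((s k *\<^sub>R t *\<^sub>R u) \<star> (s k *\<^sub>R t *\<^sub>R v)) \<in> S" for k
      using of_nat_S[OF star_S, of "s k *\<^sub>R t *\<^sub>R u" "s k *\<^sub>R t *\<^sub>R v" "Suc k"] assms
      by (simp add: lines_def s_def)
    show ?thesis
      unfolding scaleR_add_right by (rule closed_sequentially[OF closed_S _ lim]) (rule mem)
  qed
  then show ?thesis by (simp add: lines_def)
qed

lemma subspace_lines: "subspace lines"
  using lines_add lines_scaleR zero_S by (auto simp: subspace_def lines_def)

lemma lines_conj:
  assumes "u \<in> S" "v \<in> lines" shows "v + b u v + (1/2) *\<^sub>R b u (b u v) \<in> lines"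
proof -
  have "t *\<^sub>R (v + b u v + (1/2) *\<^sub>R b u (b u v)) \<in> S" for t
  proof -
    have "(u \<star> (t *\<^sub>R v)) \<star> (- u) \<in> S"
      using assms by (auto intro!: star_S uminus_S simp: lines_def)
    then show ?thesis
      unfolding star_conj by (simp add: scaleR_right scaleR_add_right mult.commute)
  qed
  then show ?thesis by (simp add: lines_def)
qed

lemma lines_bracket:
  assumes "u \<in> lines" "v \<in> lines" shows "b u v \<in> lines"
proof -
  have "u \<in> S" "- u \<in> S" using assms(1) lines_subset uminus_S by auto
  \<comment> \<open>Conjugations by \<open>u\<close> and by \<open>- u\<close> agree except for the
    sign of the term odd in \<open>u\<close>; half their difference is the bracket, without any
    differentiation.\<close>
  note lines_conj[OF this(1) assms(2)] lines_conj[OF this(2) assms(2)]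
  from subspace_scale[OF subspace_lines subspace_diff[OF subspace_lines this], of "1/2"]
  show ?thesis by (simp add: minus_left minus_right flip: scaleR_2)
qed

lemma lines_star: "u \<in> lines \<Longrightarrow> v \<in> lines \<Longrightarrow> u \<star> v \<in> lines"
  unfolding bch_def using subspace_lines
  by (intro subspace_add subspace_diff subspace_scale lines_bracket) auto

lemma lines_uminus: "u \<in> lines \<Longrightarrow> - u \<in> lines"
  using subspace_lines by (rule subspace_neg)

lemma closed_lines: "closed lines"
  by (rule closed_subspace[OF subspace_lines])

text \<open>
  An element of \<open>S\<close> near the origin is moved, within its \<open>lines\<close>-coset, as close to the origin
  as possible. If the nearest points were nonzero, their limit direction would belong to
  \<open>lines\<close>, and translating by it would bring them still closer.
\<close>

lemma small_in_lines: "\<exists>e>0. \<forall>v\<in>S. norm v < e \<longrightarrow> v \<in> lines"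
proof (rule ccontr)
  assume "\<not> ?thesis"
  then have "\<forall>k. \<exists>v. v \<in> S \<and> norm v < 1 / real (Suc k) \<and> v \<notin> lines"
    by (metis of_nat_0_less_iff zero_less_Suc zero_less_divide_1_iff)
  then obtain \<sigma> where \<sigma>: "\<And>k. \<sigma> k \<in> S" "\<And>k. norm (\<sigma> k) < 1 / real (Suc k)" "\<And>k. \<sigma> k \<notin> lines"
    by metis
  \<comment> \<open>The coset of \<open>\<sigma> k\<close> by left multiplication with
    \<open>lines\<close>; it is closed, so it has a point nearest to 0.\<close>
  define Q where "Q k = {m. m \<star> (- \<sigma> k) \<in> lines}" for k
  have "closed (Q k)" for k
    unfolding Q_def using continuous_closed_preimage[OF _ closed_UNIV closed_lines, of "\<lambda>m. m \<star> (- \<sigma> k)"]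
    by (simp add: vimage_def continuous_intros)
  moreover have \<sigma>Q: "\<sigma> k \<in> Q k" for k
    using subspace_0[OF subspace_lines] by (simp add: Q_def)
  ultimately have "\<forall>k. \<exists>m\<in>Q k. \<forall>w\<in>Q k. dist 0 m \<le> dist 0 w"
    by (metis distance_attains_inf empty_iff)
  then obtain m where mQ: "\<And>k. m k \<in> Q k" and min: "\<And>k w. w \<in> Q k \<Longrightarrow> norm (m k) \<le> norm w"
    by (metis dist_0_norm)
  have m0: "m k \<noteq> 0" for k
    using mQ[of k] \<sigma>(3)[of k] lines_uminus[of "- \<sigma> k"] by (auto simp: Q_def)
  have mS: "m k \<in> S" for k
  proof -
    have "(m k \<star> (- \<sigma> k)) \<star> \<sigma> k \<in> S"
      using mQ[of k] \<sigma>(1) lines_subset by (intro star_S[OF _ \<sigma>(1)]) (auto simp: Q_def)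
    then show ?thesis by (simp add: assoc)
  qed
  have "norm (m k) \<le> inverse (real (Suc k))" for k
    using min[OF \<sigma>Q[of k]] \<sigma>(2)[of k] by (simp add: inverse_eq_divide)
  then have mlim: "m \<longlonglongrightarrow> 0"
    by (intro Lim_null_comparison[OF _ LIMSEQ_inverse_real_of_nat] always_eventually) blast
  have "\<forall>k. m k /\<^sub>R norm (m k) \<in> sphere 0 1" using m0 by simp
  then obtain B r where r: "strict_mono r" and B: "((\<lambda>k. m k /\<^sub>R norm (m k)) \<circ> r) \<longlonglongrightarrow> B"
    by (rule seq_compactE[OF compact_sphere[of 0 1, unfolded compact_eq_seq_compact_metric]])
      (use that in blast)
  have B': "(\<lambda>k. m (r k) /\<^sub>R norm (m (r k))) \<longlonglongrightarrow> B" using B by (simp add: o_def)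
  have mr: "(\<lambda>k. m (r k)) \<longlonglongrightarrow> 0" using LIMSEQ_subseq_LIMSEQ[OF mlim r] by (simp add: o_def)
  have "B \<in> lines"
    using limit_direction_S[OF mS m0 mr B'] by (simp add: lines_def)
  define s where "s k = norm (m (r k))" for k
  \<comment> \<open>The nearest point \<open>m (r k)\<close>, moved back along \<open>B\<close> by
    its own length. Rescaling shows that \<open>U k\<close> is small compared with
    \<open>s k\<close>, whereas \<open>U k\<close> stays in the coset and so cannot be shorter than
    \<open>s k\<close>.\<close>
  define U where "U k = (s k *\<^sub>R (- B)) \<star> (s k *\<^sub>R (m (r k) /\<^sub>R s k))" for k
  have slim: "s \<longlonglongrightarrow> 0" unfolding s_def by (rule tendsto_norm_zero[OF mr])
  have "(\<lambda>k. (1 / s k) *\<^sub>R U k) \<longlonglongrightarrow> - B + B"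
    unfolding U_def using B' m0 by (intro tendsto_star_rescaled[OF slim]) (auto simp: s_def)
  then have "(\<lambda>k. norm ((1 / s k) *\<^sub>R U k)) \<longlonglongrightarrow> 0"
    by (intro tendsto_norm_zero) simp
  moreover have "1 \<le> norm ((1 / s k) *\<^sub>R U k)" for k
  proof -
    have s: "s k > 0" using m0 by (simp add: s_def)
    then have "U k \<star> (- \<sigma> (r k)) = (s k *\<^sub>R (- B)) \<star> (m (r k) \<star> (- \<sigma> (r k)))"
      by (simp add: U_def assoc)
    also have "\<dots> \<in> lines"
    proof (rule lines_star)
      show "s k *\<^sub>R (- B) \<in> lines" using \<open>B \<in> lines\<close> by (intro lines_scaleR lines_uminus)
      show "m (r k) \<star> (- \<sigma> (r k)) \<in> lines" using mQ[of "r k"] by (simp add: Q_def)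
    qed
    finally have "s k \<le> norm (U k)" using min[of "U k" "r k"] by (simp add: Q_def s_def)
    then show ?thesis using s by (simp add: field_simps)
  qed
  ultimately have "1 \<le> (0::real)" by (meson LIMSEQ_le_const)
  then show False by simp
qed

text \<open>By \<open>small_in_lines\<close>, \<open>lines\<close> contains a neighbourhood of 0 in
  \<open>S\<close>. Left translations spread this to every point of \<open>lines\<close>, which is
  then both open and closed in \<open>S\<close>.\<close>

lemma connected_imp_subspace:
  assumes "connected S" shows "subspace S"
proof -
  obtain e where e: "e > 0" "\<And>v. v \<in> S \<Longrightarrow> norm v < e \<Longrightarrow> v \<in> lines"
    using small_in_lines by blast
  have "openin (top_of_set S) lines"
    unfolding openin_subopen[of _ lines]
  proof safe
    fix a assume a: "a \<in> lines"
    define T where "T = S \<inter> (\<lambda>u. norm ((- a) \<star> u)) -` {..<e}"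
    have "openin (top_of_set S) T"
      unfolding T_def by (intro continuous_openin_preimage_gen continuous_intros)
    moreover have "a \<in> T" using a lines_subset e(1) by (auto simp: T_def)
    moreover have "T \<subseteq> lines"
    proof
      fix u assume u: "u \<in> T"
      then have "(- a) \<star> u \<in> lines"
        using a lines_subset by (intro e(2) star_S uminus_S) (auto simp: T_def)
      then have "a \<star> ((- a) \<star> u) \<in> lines" using a by (rule lines_star[rotated])
      then show "u \<in> lines" by (simp flip: assoc)
    qed
    ultimately show "\<exists>T. openin (top_of_set S) T \<and> a \<in> T \<and> T \<subseteq> lines" by blast
  qed
  moreover have "closedin (top_of_set S) lines"
    using closed_lines lines_subset by (simp add: closed_subset)
  ultimately have "lines = S"
    using assms subspace_0[OF subspace_lines] unfolding connected_clopen by blast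
  then show ?thesis using subspace_lines by simp
qed

end

end

section \<open>Exponential coordinates on $N$\<close>

lemma sum_idx:
  fixes f :: "'k::finite idx \<Rightarrow> 'a::comm_monoid_add"
  shows "(\<Sum>i\<in>UNIV. f i) = f First + f Second + (\<Sum>a\<in>UNIV. f (Mid a)) + f Penult + f Last"
proof -
  have "(\<Sum>i\<in>range Mid. f i) = (\<Sum>a\<in>UNIV. f (Mid a))"
    by (subst sum.reindex) (auto simp: inj_on_def)
  then show ?thesis
    unfolding UNIV_idx by (subst sum.union_disjoint) (auto simp: ac_simps)
qed

type_synonym 'k coord = "real \<times> (real ^ 'k) \<times> (real ^ 'k) \<times> real"

definition nil :: "'k::finite coord \<Rightarrow> 'k matrix" where
  "nil = (\<lambda>(\<phi>, x, y, \<eta>). nil_mat \<phi> x y \<eta>)"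

text \<open>The square of \<open>nil v\<close>; \<open>gcub\<close> and \<open>gquart\<close> are
  its third and fourth powers, and the fifth is zero. Separate homogeneous pieces let degrees be
  tracked in the minors.\<close>

definition gquad :: "'k::finite coord \<Rightarrow> 'k matrix" where
  "gquad = (\<lambda>(\<phi>, x, y, \<eta>). \<chi> i j. case (i, j) of
     (First, Mid b) \<Rightarrow> \<phi> * y $ b
   | (First, Penult) \<Rightarrow> - (x \<bullet> y)
   | (First, Last) \<Rightarrow> - 2 * \<phi> * \<eta> - x \<bullet> x
   | (Second, Penult) \<Rightarrow> - (y \<bullet> y)
   | (Second, Last) \<Rightarrow> - (x \<bullet> y)
   | (Mid a, Last) \<Rightarrow> \<phi> * y $ a
   | _ \<Rightarrow> 0)"

definition gcub :: "'k::finite coord \<Rightarrow> 'k matrix" where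
  "gcub = (\<lambda>(\<phi>, x, y, \<eta>). \<chi> i j. case (i, j) of
     (First, Penult) \<Rightarrow> - \<phi> * (y \<bullet> y) | (Second, Last) \<Rightarrow> \<phi> * (y \<bullet> y) | _ \<Rightarrow> 0)"

definition gquart :: "'k::finite coord \<Rightarrow> 'k matrix" where
  "gquart = (\<lambda>(\<phi>, x, y, \<eta>). \<chi> i j. case (i, j) of
     (First, Last) \<Rightarrow> \<phi>\<^sup>2 * (y \<bullet> y) | _ \<Rightarrow> 0)"

definition gexp :: "'k::finite coord \<Rightarrow> 'k matrix" where
  "gexp v = mat 1 + nil v + (1/2) *\<^sub>R gquad v + (1/6) *\<^sub>R gcub v + (1/24) *\<^sub>R gquart v"

lemmas g_defs = nil_def nil_mat_def gquad_def gcub_def gquart_def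

lemma nil_nil: "nil v ** nil v = gquad v"
proof -
  have "(nil v ** nil v) $ i $ j = gquad v $ i $ j" for i j
    by (cases v; cases i; cases j)
      (auto simp: matrix_matrix_mult_def sum_idx g_defs inner_vec_def sum_negf mult.commute)
  then show ?thesis by (simp add: vec_eq_iff)
qed

lemma nil_gquad: "nil v ** gquad v = gcub v"
proof -
  have "(nil v ** gquad v) $ i $ j = gcub v $ i $ j" for i j
    by (cases v; cases i; cases j)
      (auto simp: matrix_matrix_mult_def sum_idx g_defs inner_vec_def sum_negf sum_distrib_left algebra_simps)
  then show ?thesis by (simp add: vec_eq_iff)
qed

lemma nil_gcub: "nil v ** gcub v = gquart v"
proof -
  have "(nil v ** gcub v) $ i $ j = gquart v $ i $ j" for i j
    by (cases v; cases i; cases j)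
      (auto simp: matrix_matrix_mult_def sum_idx g_defs power2_eq_square)
  then show ?thesis by (simp add: vec_eq_iff)
qed

lemma nil_gquart: "nil v ** gquart v = 0"
proof -
  have "(nil v ** gquart v) $ i $ j = 0" for i j
    by (cases v; cases i; cases j)
      (auto simp: matrix_matrix_mult_def sum_idx g_defs)
  then show ?thesis by (simp add: vec_eq_iff)
qed

lemma mat_exp_nil: "mat_exp (nil v) = gexp v"
proof -
  define P where "P k = ((**) (nil v) ^^ k) (mat 1)" for k
  have P0: "P 0 = mat 1" by (simp add: P_def)
  have PS: "P (Suc k) = nil v ** P k" for k by (simp add: P_def)
  have P1: "P 1 = nil v" using PS[of 0] P0 by simp
  have P2: "P 2 = gquad v" using PS[of 1] P1 nil_nil[of v] by (simp add: numeral_2_eq_2)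
  have P3: "P 3 = gcub v" using PS[of 2] P2 nil_gquad[of v] by (simp add: numeral_3_eq_3)
  have P4: "P 4 = gquart v" using PS[of 3] P3 nil_gcub[of v] by (simp add: eval_nat_numeral)
  have P5: "P (k + 5) = 0" for k
  proof (induction k)
    case 0 show ?case using PS[of 4] P4 nil_gquart[of v] by (simp add: eval_nat_numeral)
  next
    case (Suc k) then show ?case using PS[of "k + 5"] by simp
  qed
  have z: "P k = 0" if "k \<notin> {..<5}" for k
    using P5[of "k - 5"] that by simp
  have "mat_exp (nil v) = (\<Sum>k. (1 / fact k) *\<^sub>R P k)" by (simp add: mat_exp_def P_def)
  also have "\<dots> = (\<Sum>k<5. (1 / fact k) *\<^sub>R P k)"
    by (rule suminf_finite) (auto simp: z)
  also have "\<dots> = P 0 + P 1 + (1/2) *\<^sub>R P 2 + (1/6) *\<^sub>R P 3 + (1/24) *\<^sub>R P 4"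
    by (simp add: eval_nat_numeral)
  also have "\<dots> = gexp v"
    unfolding P0 P1 P2 P3 P4 gexp_def ..
  finally show ?thesis .
qed

text \<open>The matrix commutator in coordinates. Brackets of phi and y give x, brackets of x and y
  give eta, and eta is central; hence nilpotency class 3.\<close>

definition br :: "'k::finite coord \<Rightarrow> 'k coord \<Rightarrow> 'k coord" where
  "br = (\<lambda>(\<phi>, x, y, \<eta>) (\<phi>', x', y', \<eta>'). (0, \<phi> *\<^sub>R y' - \<phi>' *\<^sub>R y, 0, x' \<bullet> y - x \<bullet> y'))"

lemma gexp_entries:
  "gexp (\<phi>, x, y, \<eta>) = (\<chi> i j. case (i, j) of
     (First, First) \<Rightarrow> 1 | (First, Second) \<Rightarrow> \<phi> | (First, Mid b) \<Rightarrow> (x + (\<phi>/2) *\<^sub>R y) $ b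
   | (First, Penult) \<Rightarrow> \<eta> - x \<bullet> y / 2 - \<phi> * (y \<bullet> y) / 6
   | (First, Last) \<Rightarrow> - \<phi> * \<eta> - x \<bullet> x / 2 + \<phi>\<^sup>2 * (y \<bullet> y) / 24
   | (Second, Second) \<Rightarrow> 1 | (Second, Mid b) \<Rightarrow> y $ b
   | (Second, Penult) \<Rightarrow> - (y \<bullet> y) / 2
   | (Second, Last) \<Rightarrow> - \<eta> - x \<bullet> y / 2 + \<phi> * (y \<bullet> y) / 6
   | (Mid a, Mid b) \<Rightarrow> if a = b then 1 else 0
   | (Mid a, Penult) \<Rightarrow> (- y) $ a
   | (Mid a, Last) \<Rightarrow> (- x + (\<phi>/2) *\<^sub>R y) $ a
   | (Penult, Penult) \<Rightarrow> 1 | (Penult, Last) \<Rightarrow> - \<phi>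
   | (Last, Last) \<Rightarrow> 1
   | _ \<Rightarrow> 0)" (is "_ = ?R")
proof -
  have "gexp (\<phi>, x, y, \<eta>) $ i $ j = ?R $ i $ j" for i j
    by (cases i; cases j) (auto simp: gexp_def g_defs mat_def)
  then show ?thesis by (simp add: vec_eq_iff)
qed

lemma sum_mult_inner: "(\<Sum>a\<in>UNIV. x $ a * y $ a) = x \<bullet> (y :: real ^ 'k::finite)"
  by (simp add: inner_vec_def)

text \<open>For matrices of this block shape the Baker-Campbell-Hausdorff formula is a polynomial
  identity in each entry, so no convergence enters.\<close>

lemma gexp_mult:
  fixes u v :: "'k::finite coord"
  shows "gexp u ** gexp v = gexp (bch br u v)"
proof -
  obtain \<phi> x y \<eta> where u: "u = (\<phi>, x, y, \<eta>)" by (cases u)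
  obtain \<phi>' x' y' \<eta>' where v: "v = (\<phi>', x', y', \<eta>')" by (cases v)
  have w: "bch br u v = (\<phi> + \<phi>', x + x' + (1/2) *\<^sub>R (\<phi> *\<^sub>R y' - \<phi>' *\<^sub>R y), y + y',
      \<eta> + \<eta>' + (x' \<bullet> y - x \<bullet> y') / 2 + ((\<phi> *\<^sub>R y' - \<phi>' *\<^sub>R y) \<bullet> y) / 12
        - ((\<phi> *\<^sub>R y' - \<phi>' *\<^sub>R y) \<bullet> y') / 12)"
    by (simp add: bch_def br_def u v)
  have "(gexp u ** gexp v) $ i $ j = gexp (bch br u v) $ i $ j" for i j
    unfolding w unfolding u v gexp_entries
    apply (cases i; cases j)
    \<comment> \<open>Without the component rules, rows and columns stay whole vectors and the sums
      over the middle indices fold into inner products.\<close>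
    apply (simp_all add: matrix_matrix_mult_def sum_idx sum_mult_inner 
       if_distrib[of "\<lambda>z. z * _"] if_distrib[of "\<lambda>z. _ * z"] cong: if_cong
       del: vector_add_component vector_minus_component vector_scaleR_component vector_uminus_component)
    apply (simp_all add: inner_simps inner_commute algebra_simps power2_eq_square
      add_divide_distrib diff_divide_distrib)
    done
  then show ?thesis by (simp add: vec_eq_iff)
qed

text \<open>The logarithm on N, solved triangularly from the first two rows: phi and y are entries,
  then x and eta follow after subtracting known corrections. It is polynomial, hence
  continuous.\<close>

definition gcoord :: "'k::finite matrix \<Rightarrow> 'k coord" where
  "gcoord g = (let \<phi> = g $ First $ Second; y = \<chi> b. g $ Second $ Mid b;
     x = (\<chi> b. g $ First $ Mid b) - (\<phi>/2) *\<^sub>R y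
   in (\<phi>, x, y, g $ First $ Penult + x \<bullet> y / 2 + \<phi> * (y \<bullet> y) / 6))"

lemma gcoord_gexp [simp]: "gcoord (gexp v) = v"
proof -
  obtain \<phi> x y \<eta> where v: "v = (\<phi>, x, y, \<eta>)" by (cases v)
  have *: "(\<chi> b. y $ b) = y" "(\<chi> b. x $ b + \<phi> * y $ b / 2) = x + (\<phi>/2) *\<^sub>R y"
    by (simp_all add: vec_eq_iff)
  show ?thesis unfolding v gexp_entries by (simp add: gcoord_def * Let_def)
qed

lemma continuous_on_gcoord [continuous_intros]: "continuous_on A gcoord"
  unfolding gcoord_def Let_def by (intro continuous_intros) simp_all

lemma continuous_on_gexp [continuous_intros]: "continuous_on A gexp"
proof -
  have "continuous_on A (\<lambda>(\<phi>, x, y, \<eta>). gexp (\<phi>, x, y, \<eta>) $ i $ j)" for i j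
    unfolding gexp_entries
    by (cases i; cases j) (auto simp: case_prod_beta' intro!: continuous_intros)
  then have "continuous_on A (\<lambda>v. gexp v $ i $ j)" for i j by simp
  then have "continuous_on A (\<lambda>v. \<chi> i j. gexp v $ i $ j)"
    by (intro continuous_on_vec_lambda)
  then show ?thesis by simp
qed

lemma bilinear_br: "bilinear (br :: 'k::finite coord \<Rightarrow> _)"
  unfolding bilinear_def
  by (auto intro!: linearI simp: br_def scaleR_add_right scaleR_diff_right inner_simps algebra_simps)

interpretation N: bch_group "br :: 'k::finite coord \<Rightarrow> _"
proof -
  have "bounded_bilinear (br :: 'k::finite coord \<Rightarrow> _)"
    using bilinear_br bilinear_conv_bounded_bilinear by blast
  moreover have "bch_group_axioms (br :: 'k::finite coord \<Rightarrow> _)"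
  proof
    fix u v w z :: "'k coord"
    show "br u u = 0"
      by (cases u) (simp add: br_def zero_prod_def inner_commute)
    show "br u (br v (br w z)) = 0"
      by (cases u; cases v; cases w; cases z) (simp add: br_def zero_prod_def)
    \<comment> \<open>Associativity is carried over from matrices, since \<open>gcoord\<close> is a
      left inverse of \<open>gexp\<close>.\<close>
    have "gexp (bch br (bch br u v) w) = gexp (bch br u (bch br v w))"
      by (simp add: gexp_mult[symmetric] matrix_mul_assoc)
    then show "bch br (bch br u v) w = bch br u (bch br v w)"
      by (metis gcoord_gexp)
  qed
  ultimately show "bch_group (br :: 'k::finite coord \<Rightarrow> _)" by (rule bch_group.intro)
qed

section \<open>Surjectivity of the exponential map onto N\<close>

text \<open>The Gram matrix J of the quadratic form is the permutation matrix of
  \<open>opp\<close>.\<close>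

fun opp :: "'k idx \<Rightarrow> 'k idx" where
  "opp First = Last" | "opp Second = Penult" | "opp (Mid a) = Mid a"
| "opp Penult = Second" | "opp Last = First"

definition form :: "'k::finite vector \<Rightarrow> 'k vector \<Rightarrow> real" where
  "form v w = (\<Sum>i\<in>UNIV. v $ opp i * w $ i)"

lemma form_polar: "2 * form v w = quad_form (v + w) - quad_form v - quad_form w"
  by (simp add: form_def quad_form_def sum_idx power2_eq_square sum.distrib sum_distrib_left algebra_simps)

text \<open>The relation g^T J g = J entry by entry, obtained by polarizing the invariance of
  \<open>quad_form\<close>.\<close>

lemma SO2_columns:
  assumes "g \<in> SO2"
  shows "(\<Sum>i\<in>UNIV. g $ opp i $ j * g $ i $ l) = (if j = opp l then 1 else 0)"
proof -
  have q: "quad_form (g *v v) = quad_form v" for v using assms by (simp add: SO2_def)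
  have "2 * form (g *v v) (g *v w) = 2 * form v w" for v w
    unfolding form_polar by (simp add: q flip: matrix_vector_right_distrib)
  then have "form (g *v axis j 1) (g *v axis l 1) = form (axis j 1) (axis l 1)" by simp
  also have "\<dots> = (if j = opp l then 1 else 0)"
    by (cases l; cases j) (auto simp: form_def sum_idx axis_def if_distrib[of "\<lambda>z. z * _"] cong: if_cong)
  finally show ?thesis by (simp add: form_def matrix_vector_mult_basis column_def)
qed

text \<open>The entries that \<open>gcoord\<close> reads determine the whole unipotent matrix,
  because the orthogonality relations can be solved one after another for the rest.\<close>

lemma N_set_gexp:
  fixes g :: "'k::{finite,linorder} matrix"
  assumes g: "g \<in> N_set"
  shows "gexp (gcoord g) = g"
proof -
  have "g \<in> SO2" using g by (simp add: N_set_def)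
  note rel = SO2_columns[OF this]
  have z: "g $ i $ j = 0" if "j < i" for i j using g that by (simp add: N_set_def)
  have d [simp]: "g $ i $ i = 1" for i using g by (simp add: N_set_def)
  have lower [simp]: "g $ Second $ First = 0" "g $ Mid a $ First = 0" "g $ Penult $ First = 0"
    "g $ Last $ First = 0" "g $ Mid a $ Second = 0" "g $ Penult $ Second = 0" "g $ Last $ Second = 0"
    "g $ Penult $ Mid a = 0" "g $ Last $ Mid a = 0" "g $ Last $ Penult = 0" for a
    by (rule z; simp add: less_idx_def less_eq_idx_def)+
  have mid: "g $ Mid a $ Mid b = (if a = b then 1 else 0)" for a b
  proof (cases "a = b")
    case False
    \<comment> \<open>The middle part of a column has norm 1, and its diagonal entry 1 already uses
      this up.\<close>
    have "(\<Sum>c\<in>{a, b}. (g $ Mid c $ Mid b)\<^sup>2) \<le> (\<Sum>c\<in>UNIV. (g $ Mid c $ Mid b)\<^sup>2)"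
      by (rule sum_mono2) auto
    also have "\<dots> = 1"
      using rel[of "Mid b" "Mid b"] by (simp add: sum_idx power2_eq_square)
    finally show ?thesis using False by simp
  qed simp
  define \<phi> where "\<phi> = g $ First $ Second"
  define y where "y = (\<chi> b. g $ Second $ Mid b)"
  define X where "X = (\<chi> b. g $ First $ Mid b)"
  define r where "r = g $ First $ Penult"
  note comps = vector_add_component vector_minus_component vector_scaleR_component vector_uminus_component
  have e12: "g $ First $ Second = \<phi>" by (simp add: \<phi>_def)
  have e1m: "g $ First $ Mid b = X $ b" for b by (simp add: X_def)
  have e2m: "g $ Second $ Mid b = y $ b" for b by (simp add: y_def)
  have e14: "g $ First $ Penult = r" by (simp add: r_def)
  \<comment> \<open>From here on, each relation is invoked when exactly one of its entries is still
    unknown.\<close>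
  have e45: "g $ Penult $ Last = - \<phi>"
    using rel[of Second Last] by (simp add: sum_idx e12)
  have em4: "g $ Mid b $ Penult = (- y) $ b" for b
    using rel[of "Mid b" Penult]
    by (simp add: sum_idx e2m mid if_distrib[of "\<lambda>z. z * _"] cong: if_cong)
  have em5: "g $ Mid b $ Last = (- X + \<phi> *\<^sub>R y) $ b" for b
    using rel[of "Mid b" Last]
    by (simp add: sum_idx e1m e2m e45 mid if_distrib[of "\<lambda>z. z * _"] if_distrib[of "\<lambda>z. _ * z"] algebra_simps cong: if_cong)
  have e24: "g $ Second $ Penult = - (y \<bullet> y) / 2"
    using rel[of Penult Penult]
    by (simp add: sum_idx em4 sum_mult_inner)
  have e25: "g $ Second $ Last = - r + (y \<bullet> y) / 2 * - \<phi> - (- y) \<bullet> (- X + \<phi> *\<^sub>R y)"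
    using rel[of Penult Last] 
    by (simp add: sum_idx em4 em5 e14 e24 e45 sum_mult_inner algebra_simps del: comps)
  have e15: "g $ First $ Last = (- r + (y \<bullet> y) / 2 * - \<phi> - (- y) \<bullet> (- X + \<phi> *\<^sub>R y)) * \<phi>
      - (- X + \<phi> *\<^sub>R y) \<bullet> (- X + \<phi> *\<^sub>R y) / 2"
    using rel[of Last Last]
    by (simp add: sum_idx em5 e25 e45 sum_mult_inner algebra_simps inner_commute
      add_divide_distrib diff_divide_distrib del: comps)
  have co: "gcoord g = (\<phi>, X - (\<phi>/2) *\<^sub>R y, y, r + (X - (\<phi>/2) *\<^sub>R y) \<bullet> y / 2 + \<phi> * (y \<bullet> y) / 6)"
    by (simp add: gcoord_def Let_def \<phi>_def X_def y_def r_def)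
  have "gexp (gcoord g) $ i $ j = g $ i $ j" for i j
    unfolding co gexp_entries
    by (cases i; cases j)
      (simp_all add: e12 e1m e2m e14 e45 em4 em5 e24 e25 e15 mid inner_simps inner_commute
        algebra_simps power2_eq_square add_divide_distrib diff_divide_distrib)
  then show ?thesis by (simp add: vec_eq_iff)
qed

section \<open>Tangent vectors of one-parameter subgroups of N\<close>

text \<open>Stated for arbitrary \<open>A\<close>, since an element of \<open>lie_algebra H\<close>
  is not known to be nilpotent beforehand. An everywhere convergent series can be differentiated
  termwise at 0.\<close>

lemma mat_exp_power_series:
  fixes A :: "real ^ 'm::finite ^ 'm"
  obtains c where "c 1 = A $ i $ j" "\<And>t. (\<lambda>k. c k * t ^ k) sums (mat_exp (t *\<^sub>R A) $ i $ j)"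
proof -
  define P where "P k = ((**) A ^^ k) (mat 1)" for k
  \<comment> \<open>An entry of a product with \<open>A\<close> is a sum of \<open>CARD('m)\<close>
    terms, each with a factor at most \<open>norm A\<close>.\<close>
  define M where "M = real CARD('m) * norm A"
  have PS: "P (Suc k) = A ** P k" for k by (simp add: P_def)
  have bound: "\<bar>P k $ i $ j\<bar> \<le> M ^ k" for i j k
  proof (induction k arbitrary: i j)
    case 0 show ?case by (simp add: P_def mat_def)
  next
    case (Suc k)
    have "\<bar>A $ i $ l\<bar> \<le> norm A" for l
      using order_trans[OF component_le_norm_cart Finite_Cartesian_Product.norm_nth_le[of A i]] by simp
    then have "(\<Sum>l\<in>UNIV. \<bar>A $ i $ l * P k $ l $ j\<bar>) \<le> (\<Sum>l\<in>(UNIV :: 'm set). norm A * M ^ k)"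
      by (intro sum_mono) (auto simp: abs_mult intro!: mult_mono Suc)
    then have "\<bar>\<Sum>l\<in>UNIV. A $ i $ l * P k $ l $ j\<bar> \<le> (\<Sum>l\<in>(UNIV :: 'm set). norm A * M ^ k)"
      by (rule order_trans[OF sum_abs])
    then show ?case by (simp add: PS matrix_matrix_mult_def M_def)
  qed
  have Pt: "((**) (t *\<^sub>R A) ^^ k) (mat 1) = t ^ k *\<^sub>R P k" for t k
    by (induction k) (simp_all add: P_def scalar_matrix_assoc matrix_scalar_ac mult.commute)
  have sm: "summable (\<lambda>k. (P k $ i $ j / fact k) * t ^ k)" for i j t
  proof (rule summable_comparison_test)
    have "norm ((P k $ i $ j / fact k) * t ^ k) \<le> inverse (fact k) * (M * \<bar>t\<bar>) ^ k" for k
      using mult_right_mono[OF bound[of k i j], of "\<bar>t\<bar> ^ k / fact k"]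
      by (simp add: abs_mult power_abs field_simps)
    then show "\<exists>N. \<forall>k\<ge>N. norm ((P k $ i $ j / fact k) * t ^ k) \<le> inverse (fact k) * (M * \<bar>t\<bar>) ^ k"
      by blast
    show "summable (\<lambda>k. inverse (fact k) * (M * \<bar>t\<bar>) ^ k)" by (rule summable_exp)
  qed
  have "(\<lambda>k. (P k $ i $ j / fact k) * t ^ k) sums (mat_exp (t *\<^sub>R A) $ i $ j)" for t
  proof -
    define f where "f k = (1 / fact k) *\<^sub>R ((**) (t *\<^sub>R A) ^^ k) (mat 1)" for k
    have f: "f k $ i $ j = (P k $ i $ j / fact k) * t ^ k" for k i j
      by (simp add: f_def Pt)
    have "(\<lambda>n. \<Sum>k<n. f k $ i $ j) \<longlonglongrightarrow> (\<Sum>k. f k $ i $ j)" for i j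
      unfolding f by (rule summable_LIMSEQ[OF sm])
    then have "f sums (\<chi> i j. \<Sum>k. f k $ i $ j)"
      unfolding sums_def by (intro vec_tendstoI) simp
    then have "mat_exp (t *\<^sub>R A) = (\<chi> i j. \<Sum>k. f k $ i $ j)"
      by (simp add: mat_exp_def f_def[symmetric] sums_iff)
    then show ?thesis using summable_sums[OF sm] by (simp add: f)
  qed
  moreover have "P 1 $ i $ j / fact 1 = A $ i $ j" by (simp add: P_def)
  ultimately show ?thesis by (intro that[of "\<lambda>k. P k $ i $ j / fact k"])
qed

lemma DERIV_mat_exp_0: "((\<lambda>t. mat_exp (t *\<^sub>R A) $ i $ j) has_real_derivative A $ i $ j) (at 0)"
proof -
  obtain c where c: "c 1 = A $ i $ j" "\<And>t. (\<lambda>k. c k * t ^ k) sums (mat_exp (t *\<^sub>R A) $ i $ j)"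
    by (rule mat_exp_power_series[of A i j]) (rule that)
  have "((\<lambda>t. \<Sum>k. c k * t ^ k) has_real_derivative (\<Sum>k. diffs c k * 0 ^ k)) (at 0)"
    using c(2) by (intro termdiffs_strong_converges_everywhere) (auto simp: sums_iff)
  moreover have "(\<Sum>k. diffs c k * 0 ^ k) = A $ i $ j"
    using c(1) by (simp add: powser_zero diffs_def)
  moreover have "(\<lambda>t. \<Sum>k. c k * t ^ k) = (\<lambda>t. mat_exp (t *\<^sub>R A) $ i $ j)"
    using c(2) by (simp add: sums_iff)
  ultimately show ?thesis by simp
qed

lemma mat_exp_0: "mat_exp 0 = mat 1"
proof -
  have "((**) (0 :: real ^ 'a ^ 'a) ^^ k) (mat 1) = (if k = 0 then mat 1 else 0)" for k
    by (cases k) auto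
  then have "mat_exp (0 :: real ^ 'a ^ 'a) = (\<Sum>k. if k = 0 then mat 1 else 0)"
    unfolding mat_exp_def by (intro suminf_cong) simp
  also have "\<dots> = (\<Sum>k\<in>{0::nat}. if k = 0 then mat 1 else 0)"
    by (rule suminf_finite) auto
  finally show ?thesis by simp
qed

text \<open>The equations that define N are differentiated at the identity: unitriangularity gives
  strict triangularity, orthogonality gives skewness about the antidiagonal.\<close>

lemma one_param_N_set:
  fixes A :: "'k::{finite,linorder} matrix"
  assumes N: "\<And>t. mat_exp (t *\<^sub>R A) \<in> N_set"
  shows "A \<in> range nil"
proof -
  define f where "f i j t = mat_exp (t *\<^sub>R A) $ i $ j" for i j t
  have f: "(f i j has_real_derivative A $ i $ j) (at 0)" for i j
    unfolding f_def by (rule DERIV_mat_exp_0)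
  have const: "D = 0" if "(h has_real_derivative D) (at 0)" "\<And>t. h t = k" for h :: "real \<Rightarrow> real" and D k
  proof -
    have "h = (\<lambda>t. k)" using that(2) by blast
    then show ?thesis using that(1) DERIV_const[of k "at 0"] DERIV_unique by blast
  qed
  have f0: "f i j 0 = (if i = j then 1 else 0)" for i j
    by (simp add: f_def mat_exp_0 mat_def)
  have low: "A $ i $ j = 0" if "j \<le> i" for i j
  proof (cases "i = j")
    case True then show ?thesis using N by (intro const[OF f, of _ _ 1]) (auto simp: f_def N_set_def)
  next
    case False with that have "j < i" by simp
    then show ?thesis using N by (intro const[OF f, of _ _ 0]) (auto simp: f_def N_set_def)
  qed
  have skew: "A $ opp l $ j + A $ opp j $ l = 0" for j l
  proof -
    have "((\<lambda>t. \<Sum>i\<in>UNIV. f (opp i) j t * f i l t) has_real_derivative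
        (\<Sum>i\<in>UNIV. A $ opp i $ j * f i l 0 + A $ i $ l * f (opp i) j 0)) (at 0)"
      by (intro DERIV_sum DERIV_mult f)
    moreover have "(\<Sum>i\<in>UNIV. f (opp i) j t * f i l t) = (if j = opp l then 1 else 0)" for t
      using SO2_columns[of "mat_exp (t *\<^sub>R A)" j l] N[of t] by (simp add: f_def N_set_def)
    ultimately have "(\<Sum>i\<in>UNIV. A $ opp i $ j * f i l 0 + A $ i $ l * f (opp i) j 0) = 0"
      by (rule const)
    then show ?thesis
      by (cases l; cases j) (simp_all add: sum_idx f0 sum.distrib if_distrib[of "\<lambda>z. _ * z"] cong: if_cong)
  qed
  have lower [simp]: "A $ i $ i = 0" "A $ Second $ First = 0" "A $ Mid a $ First = 0" "A $ Penult $ First = 0"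
    "A $ Last $ First = 0" "A $ Mid a $ Second = 0" "A $ Penult $ Second = 0" "A $ Last $ Second = 0"
    "A $ Penult $ Mid a = 0" "A $ Last $ Mid a = 0" "A $ Last $ Penult = 0" for a i
    by (rule low; simp add: less_eq_idx_def)+
  \<comment> \<open>The middle block is skew-symmetric and strictly upper triangular at
    once.\<close>
  have mid: "A $ Mid a $ Mid b = 0" for a b
  proof (cases "b \<le> a")
    case True then show ?thesis by (intro low) (simp add: less_eq_idx_def)
  next
    case False then have "A $ Mid b $ Mid a = 0" by (intro low) (simp add: less_eq_idx_def)
    then show ?thesis using skew[of "Mid a" "Mid b"] by simp
  qed
  have "A $ i $ j = nil (phi_of A, x_of A, y_of A, eta_of A) $ i $ j" for i j
    using skew[of j "opp i"]
    by (cases i; cases j) (simp_all add: nil_def nil_mat_def phi_of_def x_of_def y_of_def eta_of_def mid)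
  then have "A = nil (phi_of A, x_of A, y_of A, eta_of A)" by (simp add: vec_eq_iff)
  then show ?thesis by blast
qed

section \<open>From subgroups of N to subspaces\<close>

lemma gexp_0: "gexp 0 = mat 1"
proof -
  have "gexp (0 :: 'a coord) $ i $ j = mat 1 $ i $ j" for i j
    unfolding zero_prod_def gexp_entries by (cases i; cases j) (auto simp: mat_def)
  then show ?thesis by (simp add: vec_eq_iff)
qed

lemma nil_scaleR: "nil (t *\<^sub>R v) = t *\<^sub>R nil v"
proof -
  have "nil (t *\<^sub>R v) $ i $ j = (t *\<^sub>R nil v) $ i $ j" for i j
    by (cases v; cases i; cases j) (auto simp: nil_def nil_mat_def)
  then show ?thesis by (simp add: vec_eq_iff)
qed

lemma closed_N_set: "closed N_set"
proof -
  have "continuous_on UNIV (\<lambda>g :: 'a matrix. det g)"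
    unfolding det_def by (intro continuous_intros)
  moreover have "continuous_on UNIV (\<lambda>g :: 'a matrix. quad_form (g *v v))" for v
    unfolding quad_form_def matrix_vector_mult_def by (simp, intro continuous_intros)
  ultimately show ?thesis
    unfolding N_set_def SO2_def mem_Collect_eq
    by (intro closed_Collect_conj closed_Collect_all closed_Collect_imp closed_Collect_eq
      open_Collect_const continuous_intros)
qed

text \<open>The inverse in \<open>N_group\<close> is a definite description over the carrier, so
  both membership of \<open>gexp (- v)\<close> in \<open>N_set\<close> and uniqueness have to be
  checked.\<close>

lemma N_set_inverse:
  assumes N: "gexp v \<in> N_set"
  shows "inv\<^bsub>N_group\<^esub> (gexp v) = gexp (- v)"
proof -
  let ?g = "gexp v" and ?h = "gexp (- v)"
  have gh: "?g ** ?h = mat 1" "?h ** ?g = mat 1"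
    by (simp_all add: gexp_mult gexp_0)
  have "det ?h = det (?g ** ?h)" using N unfolding det_mul by (simp add: N_set_def SO2_def)
  then have det: "det ?h = 1" by (simp add: gh)
  have "quad_form (?h *v w) = quad_form (?g *v (?h *v w))" for w
    using N by (simp add: N_set_def SO2_def)
  then have "?h \<in> SO2" using det by (simp add: SO2_def matrix_vector_mul_assoc gh)
  moreover have "?h $ i $ j = 0" if "j < i" for i j
    using that by (cases v; cases i; cases j) (auto simp: gexp_entries less_idx_def less_eq_idx_def)
  moreover have "?h $ i $ i = 1" for i
    by (cases v; cases i) (auto simp: gexp_entries)
  ultimately have hN: "?h \<in> N_set" by (simp add: N_set_def)
  show ?thesis
    unfolding m_inv_def
  proof (rule the_equality)
    show "?h \<in> carrier N_group \<and> ?g \<otimes>\<^bsub>N_group\<^esub> ?h = \<one>\<^bsub>N_group\<^esub> \<and>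
        ?h \<otimes>\<^bsub>N_group\<^esub> ?g = \<one>\<^bsub>N_group\<^esub>"
      using hN gh by (simp add: N_group_def)
  next
    fix y
    assume "y \<in> carrier N_group \<and> ?g \<otimes>\<^bsub>N_group\<^esub> y = \<one>\<^bsub>N_group\<^esub> \<and>
        y \<otimes>\<^bsub>N_group\<^esub> ?g = \<one>\<^bsub>N_group\<^esub>"
    then have "?g ** y = mat 1" by (simp add: N_group_def)
    then have "(?h ** ?g) ** y = ?h ** mat 1" by (simp only: matrix_mul_assoc[symmetric])
    then show "y = ?h" by (simp add: gh)
  qed
qed

text \<open>Closedness and the group laws pull back along \<open>gexp\<close>, and connectedness is
  pushed forward along \<open>gcoord\<close>, so \<open>N.connected_imp_subspace\<close> applies. A
  tangent vector is of the form \<open>nil v\<close>, and its exponential at time 1 shows that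
  \<open>v\<close> lies in \<open>S\<close>.\<close>

lemma connected_subgroup_coords:
  fixes H :: "'k::{finite,linorder} matrix set"
  assumes sub: "subgroup H N_group" and clo: "closedin (top_of_set N_set) H" and con: "connected H"
  obtains S where "subspace S" "H = gexp ` S" "lie_algebra H = nil ` S"
proof -
  define S where "S = gexp -` H"
  have HN: "H \<subseteq> N_set" using subgroup.subset[OF sub] by (simp add: N_group_def)
  have HS: "H = gexp ` S"
  proof (intro equalityI subsetI)
    fix h assume h: "h \<in> H"
    then have "gexp (gcoord h) = h" using HN by (intro N_set_gexp) blast
    then show "h \<in> gexp ` S" using h by (intro image_eqI[of _ _ "gcoord h"]) (simp_all add: S_def)
  qed (auto simp: S_def)
  have S_coord: "S = gcoord ` H" unfolding HS by (auto simp: image_image)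
  have "closed H" using clo closed_N_set by (rule closedin_closed_trans)
  then have "closed S"
    unfolding S_def by (intro closed_vimage continuous_on_gexp)
  moreover have "0 \<in> S"
    using subgroup.one_closed[OF sub] by (simp add: S_def gexp_0 N_group_def)
  moreover have "bch br u v \<in> S" if "u \<in> S" "v \<in> S" for u v
    using subgroup.m_closed[OF sub, of "gexp u" "gexp v"] that
    by (simp add: S_def N_group_def gexp_mult)
  moreover have "- u \<in> S" if "u \<in> S" for u
    using subgroup.m_inv_closed[OF sub, of "gexp u"] that HN N_set_inverse[of u]
    by (auto simp: S_def)
  moreover have "connected S"
    unfolding S_coord using continuous_on_gcoord con by (rule connected_continuous_image)
  ultimately have "subspace S" by (rule N.connected_imp_subspace)
  moreover have "lie_algebra H = nil ` S"
  proof (intro equalityI subsetI)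
    fix A assume A: "A \<in> lie_algebra H"
    then have "A \<in> range nil"
      using HN by (intro one_param_N_set) (auto simp: lie_algebra_def)
    then obtain v where v: "A = nil v" by blast
    have "mat_exp (1 *\<^sub>R A) \<in> H" using A unfolding lie_algebra_def by blast
    then show "A \<in> nil ` S" by (simp add: v mat_exp_nil S_def)
  next
    fix A assume "A \<in> nil ` S"
    then obtain v where v: "v \<in> S" "A = nil v" by blast
    then have "t *\<^sub>R v \<in> S" for t using \<open>subspace S\<close> by (simp add: subspace_scale)
    then show "A \<in> lie_algebra H"
      by (simp add: lie_algebra_def v(2) mat_exp_nil S_def flip: nil_scaleR)
  qed
  ultimately show ?thesis using HS that by blast
qed

lemma is_norm_equivalent:
  fixes \<nu> :: "'v::euclidean_space \<Rightarrow> real"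
  assumes "is_norm \<nu>"
  obtains c where "c \<ge> 1" "\<And>v. \<nu> v \<le> c * norm v" "\<And>v. norm v \<le> c * \<nu> v"
proof -
  have nn: "\<nu> v \<ge> 0" and zero: "\<nu> v = 0 \<longleftrightarrow> v = 0" and scale: "\<nu> (a *\<^sub>R v) = \<bar>a\<bar> * \<nu> v"
    and tri: "\<nu> (v + w) \<le> \<nu> v + \<nu> w" for v w a
    using assms by (auto simp: is_norm_def)
  define B where "B = (\<Sum>b\<in>Basis. \<nu> b)"
  have sum_le: "\<nu> (sum f A) \<le> (\<Sum>x\<in>A. \<nu> (f x))" if "finite A" for f :: "'v \<Rightarrow> 'v" and A
    using that
  proof induction
    case empty show ?case using zero[of 0] by simp
  next
    case (insert x F) then show ?case using tri[of "f x" "sum f F"] by simp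
  qed
  have upper: "\<nu> v \<le> B * norm v" for v
  proof -
    have "\<nu> v = \<nu> (\<Sum>b\<in>Basis. (v \<bullet> b) *\<^sub>R b)" by (simp add: euclidean_representation)
    also have "\<dots> \<le> (\<Sum>b\<in>Basis. \<nu> ((v \<bullet> b) *\<^sub>R b))" by (rule sum_le) simp
    also have "\<dots> \<le> (\<Sum>b\<in>Basis. norm v * \<nu> b)"
      unfolding scale by (intro sum_mono mult_right_mono Basis_le_norm nn)
    finally show ?thesis by (simp add: B_def sum_distrib_left[symmetric] mult.commute)
  qed
  have B: "B \<ge> 0" unfolding B_def by (intro sum_nonneg nn)
  have "\<bar>\<nu> v - \<nu> w\<bar> \<le> B * norm (v - w)" for v w
    using tri[of "v - w" w] tri[of "w - v" v] upper[of "v - w"] upper[of "w - v"]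
    by (simp add: norm_minus_commute)
  then have "B-lipschitz_on UNIV \<nu>"
    using B by (intro lipschitz_onI) (auto simp: dist_norm)
  then have "continuous_on (sphere 0 1) \<nu>"
    using lipschitz_on_continuous_on continuous_on_subset by blast
  moreover have "sphere (0::'v) 1 \<noteq> {}" by simp
  ultimately obtain u where u: "u \<in> sphere 0 1" "\<And>v. v \<in> sphere 0 1 \<Longrightarrow> \<nu> u \<le> \<nu> v"
    using continuous_attains_inf[OF compact_sphere[of "0::'v" 1]] by metis
  have "u \<noteq> 0" using u(1) by auto
  then have pos: "\<nu> u > 0" using nn[of u] zero[of u] by simp
  have lower: "\<nu> u * norm v \<le> \<nu> v" for v
  proof (cases "v = 0")
    case True then show ?thesis using nn by simp
  next
    case False
    then have "\<nu> u \<le> \<nu> ((1 / norm v) *\<^sub>R v)" by (intro u(2)) simp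
    then show ?thesis using False by (simp add: scale field_simps)
  qed
  define c where "c = max 1 (max B (1 / \<nu> u))"
  have c: "B \<le> c" "1 / \<nu> u \<le> c" by (auto simp: c_def)
  show ?thesis
  proof
    show "c \<ge> 1" by (simp add: c_def)
    show "\<nu> v \<le> c * norm v" for v
      using upper mult_right_mono[OF c(1) norm_ge_zero] by (rule order_trans)
    have "norm v \<le> (1 / \<nu> u) * \<nu> v" for v
      using lower[of v] pos by (simp add: field_simps)
    then show "norm v \<le> c * \<nu> v" for v
      using mult_right_mono[OF c(2) nn] by (rule order_trans)
  qed
qed

section \<open>Growth of entries and minors\<close>

definition minor :: "'k::finite matrix \<Rightarrow> 'k idx \<Rightarrow> 'k idx \<Rightarrow> 'k idx \<Rightarrow> 'k idx \<Rightarrow> real" where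
  "minor g i k j l = g $ i $ j * g $ k $ l - g $ i $ l * g $ k $ j"

lemma rho_entry:
  "rho g $ p $ q = minor g (row_idx p) (col_idx p) (row_idx q) (col_idx q)"
  by (simp add: rho_def wedge_def minor_def matrix_vector_mult_basis column_def)

lemma entry_le_norm: "\<bar>(A :: real ^ 'm::finite ^ 'n::finite) $ i $ j\<bar> \<le> norm A"
  using order_trans[OF component_le_norm_cart Finite_Cartesian_Product.norm_nth_le[of A i]] by simp

lemma norm_le_entries:
  fixes A :: "real ^ 'm::finite ^ 'n::finite"
  assumes "\<And>i j. \<bar>A $ i $ j\<bar> \<le> C"
  shows "norm A \<le> real CARD('n) * real CARD('m) * C"
proof -
  have "norm (A $ i) \<le> real CARD('m) * C" for i
    using norm_le_l1_cart[of "A $ i"] sum_mono[of UNIV "\<lambda>j. \<bar>A $ i $ j\<bar>" "\<lambda>j. C"] assms by simp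
  then have "(\<Sum>i\<in>UNIV. norm (A $ i)) \<le> (\<Sum>i\<in>(UNIV::'n set). real CARD('m) * C)"
    by (intro sum_mono)
  moreover have "norm A \<le> (\<Sum>i\<in>UNIV. norm (A $ i))"
    unfolding norm_vec_def by (rule L2_set_le_sum) simp
  ultimately show ?thesis by simp
qed

lemma idx_less:
  "First < (Second :: 'k::linorder idx)" "First < (Penult :: 'k idx)" "Second < (Last :: 'k idx)" "Penult < (Last :: 'k idx)"
  by (simp_all add: less_idx_def less_eq_idx_def)

lemma minor_le_norm_rho:
  assumes "i < k" "j < l"
  shows "\<bar>minor g i k j l\<bar> \<le> norm (rho g)"
proof -
  have "rho g $ Abs_wedge_idx (i, k) $ Abs_wedge_idx (j, l) = minor g i k j l"
    using assms by (simp add: rho_entry Abs_wedge_idx_inverse)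
  then show ?thesis using entry_le_norm[of "rho g"] by metis
qed

lemma row_less_col: "row_idx p < col_idx p"
  using Rep_wedge_idx[of p] by simp

text \<open>The size \<open>M v\<close> mediates: h is compared with \<open>M\<close> and
  \<open>rho h\<close> with its k-th power, then \<open>M\<close> is eliminated. Upper bounds may be
  checked entrywise, and a single large entry suffices for each lower bound. The ball of radius
  \<open>R\<close> supplies the exceptional compact set.\<close>

lemma rho_asympI:
  fixes S :: "'k::{finite,linorder} coord set"
  assumes \<nu>: "is_norm \<nu>" and \<nu>': "is_norm \<nu>'" and S: "closed S" and H: "H = gexp ` S"
    and k: "k > 0" and C: "C > 0"
    and M: "\<And>v. v \<in> S \<Longrightarrow> norm v \<ge> R \<Longrightarrow> M v \<ge> 0"
    and g_upper: "\<And>v i j. v \<in> S \<Longrightarrow> norm v \<ge> R \<Longrightarrow> \<bar>gexp v $ i $ j\<bar> \<le> C * M v"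
    and g_lower: "\<And>v. v \<in> S \<Longrightarrow> norm v \<ge> R \<Longrightarrow> M v \<le> C * norm (gexp v)"
    and rho_upper: "\<And>v i j r s. v \<in> S \<Longrightarrow> norm v \<ge> R \<Longrightarrow> i < r \<Longrightarrow> j < s \<Longrightarrow>
      \<bar>minor (gexp v) i r j s\<bar> \<le> C * M v powr k"
    and rho_lower: "\<And>v. v \<in> S \<Longrightarrow> norm v \<ge> R \<Longrightarrow> M v powr k \<le> C * norm (rho (gexp v))"
  shows "rho_asymp \<nu> \<nu>' H k"
proof -
  obtain a where a: "a \<ge> 1" "\<And>v. \<nu> v \<le> a * norm v" "\<And>v. norm v \<le> a * \<nu> v"
    using is_norm_equivalent[OF \<nu>] by metis
  obtain b where b: "b \<ge> 1" "\<And>v. \<nu>' v \<le> b * norm v" "\<And>v. norm v \<le> b * \<nu>' v"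
    using is_norm_equivalent[OF \<nu>'] by metis
  have \<nu>0: "\<nu> v \<ge> 0" for v using \<nu> by (simp add: is_norm_def)
  define n where "n = real CARD('k idx) * real CARD('k idx)"
  define n' where "n' = real CARD('k wedge_idx) * real CARD('k wedge_idx)"
  define D where "D = a * (n * C)"
  define E where "E = C * a"
  define c where "c = max 1 (max (D powr k * (C * b)) (b * (n' * C) * E powr k))"
  have D: "D \<ge> 0" and E: "E \<ge> 0" using a(1) C by (simp_all add: D_def E_def n_def)
  have main: "\<nu> (gexp v) powr k \<le> c * \<nu>' (rho (gexp v)) \<and> \<nu>' (rho (gexp v)) \<le> c * \<nu> (gexp v) powr k"
    if v: "v \<in> S" "norm v \<ge> R" for v
  proof
    let ?g = "gexp v"
    have "norm ?g \<le> n * (C * M v)"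
      unfolding n_def by (rule norm_le_entries) (rule g_upper[OF v])
    then have "\<nu> ?g \<le> D * M v"
      using order_trans[OF a(2)[of ?g] mult_left_mono[of "norm ?g" "n * (C * M v)" a]] a(1)
      by (simp add: D_def mult_ac)
    then have "\<nu> ?g powr k \<le> (D * M v) powr k" using \<nu>0 k by (intro powr_mono2) auto
    also have "\<dots> = D powr k * M v powr k" using D M[OF v] by (simp add: powr_mult)
    also have "\<dots> \<le> D powr k * (C * (b * \<nu>' (rho ?g)))"
      using rho_lower[OF v] b(3)[of "rho ?g"] C
      by (intro mult_left_mono) (auto intro: order_trans mult_left_mono)
    also have "\<dots> = (D powr k * (C * b)) * \<nu>' (rho ?g)" by simp
    also have "\<dots> \<le> c * \<nu>' (rho ?g)"
      using \<nu>' by (intro mult_right_mono) (auto simp: c_def is_norm_def)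
    finally show "\<nu> ?g powr k \<le> c * \<nu>' (rho ?g)" .
    have "norm (rho ?g) \<le> n' * (C * M v powr k)"
      unfolding n'_def by (rule norm_le_entries) (simp add: rho_entry rho_upper[OF v] row_less_col)
    then have "\<nu>' (rho ?g) \<le> b * (n' * (C * M v powr k))"
      using order_trans[OF b(2)[of "rho ?g"] mult_left_mono[of "norm (rho ?g)" "n' * (C * M v powr k)" b]] b(1)
      by simp
    also have "\<dots> = b * (n' * C) * M v powr k" by simp
    finally have up: "\<nu>' (rho ?g) \<le> b * (n' * C) * M v powr k" .
    have "M v \<le> E * \<nu> ?g"
      using order_trans[OF g_lower[OF v] mult_left_mono[OF a(3)[of ?g], of C]] C
      by (simp add: E_def mult_ac)
    then have "M v powr k \<le> (E * \<nu> ?g) powr k" using M[OF v] k by (intro powr_mono2) auto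
    also have "\<dots> = E powr k * \<nu> ?g powr k" using E \<nu>0 by (simp add: powr_mult)
    finally have "b * (n' * C) * M v powr k \<le> b * (n' * C) * (E powr k * \<nu> ?g powr k)"
      using b(1) C by (intro mult_left_mono) (auto simp: n'_def)
    with up have "\<nu>' (rho ?g) \<le> (b * (n' * C) * E powr k) * \<nu> ?g powr k"
      by (simp only: mult.assoc)
    also have "\<dots> \<le> c * \<nu> ?g powr k"
      by (intro mult_right_mono) (auto simp: c_def)
    finally show "\<nu>' (rho ?g) \<le> c * \<nu> ?g powr k" .
  qed
  define K where "K = gexp ` (S \<inter> cball 0 R)"
  have "compact K" unfolding K_def
    using S by (intro compact_continuous_image continuous_on_gexp) (simp add: compact_Int_closed closed_Int_compact)
  moreover have "K \<subseteq> H" by (auto simp: K_def H)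
  moreover have "\<nu> h powr k / c \<le> \<nu>' (rho h) \<and> \<nu>' (rho h) \<le> c * \<nu> h powr k" if h: "h \<in> H - K" for h
  proof -
    obtain v where v: "v \<in> S" "h = gexp v" using h H by blast
    then have "norm v \<ge> R" using h by (auto simp: K_def)
    moreover have "c \<ge> 1" by (simp add: c_def)
    ultimately show ?thesis using main[OF v(1)] by (simp add: v(2) field_simps)
  qed
  moreover have "c \<ge> 1" by (simp add: c_def)
  ultimately show ?thesis unfolding rho_asymp_def by blast
qed

text \<open>The constant is the minimum of \<open>f\<close> on the unit sphere of \<open>S\<close>,
  and homogeneity does the rest. If \<open>S\<close> is trivial that sphere is empty and any
  constant serves.\<close>

lemma homogeneous_lower_bound:
  fixes f :: "'v::euclidean_space \<Rightarrow> real"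
  assumes S: "subspace S" and f: "continuous_on S f" and d: "d > 0"
    and hom: "\<And>t v. f (t *\<^sub>R v) = \<bar>t\<bar> ^ d * f v"
    and pos: "\<And>v. v \<in> S \<Longrightarrow> v \<noteq> 0 \<Longrightarrow> f v > 0"
  obtains c where "c > 0" "\<And>v. v \<in> S \<Longrightarrow> c * norm v ^ d \<le> f v"
proof -
  define K where "K = S \<inter> sphere 0 1"
  have "compact K" unfolding K_def
    using closed_subspace[OF S] by (simp add: closed_Int_compact)
  have f0: "f 0 = 0" using hom[of 0 0] d by (simp add: zero_power)
  obtain c where c: "c > 0" "\<And>v. v \<in> K \<Longrightarrow> c \<le> f v"
  proof (cases "K = {}")
    case True then show ?thesis using that[of 1] by simp
  next
    case False
    have "continuous_on K f" using f by (rule continuous_on_subset) (simp add: K_def)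
    then obtain u where u: "u \<in> K" "\<forall>v\<in>K. f u \<le> f v"
      using continuous_attains_inf[OF \<open>compact K\<close> False] by blast
    then have "f u > 0" using pos[of u] by (cases "u = 0") (auto simp: K_def)
    then show ?thesis using u(2) that by blast
  qed
  have "c * norm v ^ d \<le> f v" if v: "v \<in> S" for v
  proof (cases "v = 0")
    case True then show ?thesis using f0 d by (simp add: zero_power)
  next
    case False
    then have "(1 / norm v) *\<^sub>R v \<in> K" using v S by (simp add: K_def subspace_scale)
    then have "c \<le> f ((1 / norm v) *\<^sub>R v)" by (rule c(2))
    also have "\<dots> = f v / norm v ^ d" by (simp add: hom power_divide)
    finally show ?thesis using False by (simp add: field_simps)
  qed
  then show ?thesis using c(1) that by blast
qed

lemma norm_coord: "(norm (\<phi> :: real, x :: real ^ 'k::finite, y :: real ^ 'k, \<eta> :: real))\<^sup>2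
    = \<phi>\<^sup>2 + x \<bullet> x + y \<bullet> y + \<eta>\<^sup>2"
  by (simp add: norm_Pair power2_norm_eq_inner)

lemma coord_le_norm:
  fixes x y :: "real ^ 'k::finite" and \<phi> \<eta> :: real
  defines "n \<equiv> norm (\<phi>, x, y, \<eta>)"
  shows "\<bar>\<phi>\<bar> \<le> n" "norm x \<le> n" "norm y \<le> n" "\<bar>\<eta>\<bar> \<le> n" "\<bar>x $ b\<bar> \<le> n" "\<bar>y $ b\<bar> \<le> n"
proof -
  have n: "n \<ge> 0" "n\<^sup>2 = \<phi>\<^sup>2 + (norm x)\<^sup>2 + (norm y)\<^sup>2 + \<eta>\<^sup>2"
    unfolding n_def norm_coord by (simp_all add: power2_norm_eq_inner)
  have "\<bar>\<phi>\<bar>\<^sup>2 \<le> n\<^sup>2" "(norm x)\<^sup>2 \<le> n\<^sup>2" "(norm y)\<^sup>2 \<le> n\<^sup>2" "\<bar>\<eta>\<bar>\<^sup>2 \<le> n\<^sup>2"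
    unfolding n(2) power2_abs
    using zero_le_power2[of \<phi>] zero_le_power2[of \<eta>] zero_le_power2[of "norm x"] zero_le_power2[of "norm y"]
    by linarith+
  then show "\<bar>\<phi>\<bar> \<le> n" "norm x \<le> n" "norm y \<le> n" "\<bar>\<eta>\<bar> \<le> n"
    using n(1) by (blast intro: power2_le_imp_le)+
  then show "\<bar>x $ b\<bar> \<le> n" "\<bar>y $ b\<bar> \<le> n"
    using component_le_norm_cart order_trans by blast+
qed

lemma nil_le_norm: "\<bar>nil v $ i $ j\<bar> \<le> norm v"
proof -
  obtain \<phi> x y \<eta> where v: "v = (\<phi>, x, y, \<eta>)" by (cases v)
  show ?thesis
    unfolding v using coord_le_norm[where \<phi> = \<phi> and x = x and y = y and \<eta> = \<eta>]
    by (cases i; cases j) (auto simp: nil_def nil_mat_def)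
qed

lemma gquad_le_norm: "\<bar>gquad v $ i $ j\<bar> \<le> 3 * (norm v)\<^sup>2"
proof -
  obtain \<phi> x y \<eta> where v: "v = (\<phi>, x, y, \<eta>)" by (cases v)
  define n where "n = norm v"
  have n: "n \<ge> 0" by (simp add: n_def)
  note le = coord_le_norm[where \<phi> = \<phi> and x = x and y = y and \<eta> = \<eta>, folded v, folded n_def]
  have prod: "\<bar>a * b\<bar> \<le> n\<^sup>2" if "\<bar>a\<bar> \<le> n" "\<bar>b\<bar> \<le> n" for a b
    using mult_mono[OF that] n by (simp add: abs_mult power2_eq_square)
  have inn: "\<bar>z \<bullet> w\<bar> \<le> n\<^sup>2" if "norm z \<le> n" "norm w \<le> n" for z w :: "real ^ 'a"
    using order_trans[OF Cauchy_Schwarz_ineq2 mult_mono[OF that]] n by (simp add: power2_eq_square)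
  have "\<bar>\<phi> * y $ b\<bar> \<le> n\<^sup>2" "\<bar>\<phi> * \<eta>\<bar> \<le> n\<^sup>2" "\<bar>x \<bullet> y\<bar> \<le> n\<^sup>2" "\<bar>x \<bullet> x\<bar> \<le> n\<^sup>2" "\<bar>y \<bullet> y\<bar> \<le> n\<^sup>2" for b
    by (intro prod inn le)+
  note b = this
  \<comment> \<open>The upper right corner is the entry that forces the constant 3.\<close>
  have b6: "\<bar>- (2 * \<phi> * \<eta>) - x \<bullet> x\<bar> \<le> 3 * n\<^sup>2"
    using b(2,4) unfolding mult.assoc by linarith
  have "n\<^sup>2 \<ge> 0" by simp
  have "\<bar>gquad (\<phi>, x, y, \<eta>) $ i $ j\<bar> \<le> 3 * n\<^sup>2"
    using \<open>n\<^sup>2 \<ge> 0\<close> b(2-5) b6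
    by (cases i; cases j) (auto simp: gquad_def intro: order_trans[OF b(1)])
  then show ?thesis by (simp add: v n_def)
qed

lemma minor_le:
  assumes "\<And>i j. \<bar>g $ i $ j\<bar> \<le> B"
  shows "\<bar>minor g i k j l\<bar> \<le> 2 * B\<^sup>2"
proof -
  have B: "B \<ge> 0" using assms[of i j] by simp
  have "\<bar>g $ i $ j * g $ k $ l\<bar> \<le> B\<^sup>2" "\<bar>g $ i $ l * g $ k $ j\<bar> \<le> B\<^sup>2"
    using mult_mono[OF assms[of i j] assms[of k l]] mult_mono[OF assms[of i l] assms[of k j]] B
    by (simp_all add: abs_mult power2_eq_square)
  then show ?thesis unfolding minor_def by linarith
qed

section \<open>Subgroups with exponent 1\<close>

text \<open>The polarization of the quadratic map \<open>minor\<close>.\<close>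

definition minor2 :: "'k::finite matrix \<Rightarrow> 'k matrix \<Rightarrow> 'k idx \<Rightarrow> 'k idx \<Rightarrow> 'k idx \<Rightarrow> 'k idx \<Rightarrow> real" where
  "minor2 g h i k j l = g $ i $ j * h $ k $ l + h $ i $ j * g $ k $ l - g $ i $ l * h $ k $ j - h $ i $ l * g $ k $ j"

lemma minor_expand:
  "minor (g + h + s *\<^sub>R q) i k j l = minor (g + h) i k j l
     + s * minor2 g q i k j l + s * minor2 h q i k j l + s\<^sup>2 * minor q i k j l"
  by (simp add: minor_def minor2_def algebra_simps power2_eq_square)

text \<open>
  The assumptions \<open>mixed\<close> and \<open>quad\<close> say that the terms of degree 3 and 4 in the minors of
  \<open>gexp v = mat 1 + nil v + gquad v / 2\<close> vanish.
\<close>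

lemma rho_asymp_1I:
  fixes S :: "'k::{finite,linorder} coord set"
  assumes \<nu>: "is_norm \<nu>" and \<nu>': "is_norm \<nu>'" and S: "subspace S" and H: "H = gexp ` S"
    and c: "c > 0"
    and cub: "\<And>v. v \<in> S \<Longrightarrow> gcub v = 0" "\<And>v. v \<in> S \<Longrightarrow> gquart v = 0"
    and mixed: "\<And>v i k j l. v \<in> S \<Longrightarrow> minor2 (nil v) (gquad v) i k j l = 0"
    and quad: "\<And>v i k j l. v \<in> S \<Longrightarrow> minor (gquad v) i k j l = 0"
    and g_lower: "\<And>v. v \<in> S \<Longrightarrow> c * (norm v)\<^sup>2 \<le> norm (gexp v)"
    and rho_lower: "\<And>v. v \<in> S \<Longrightarrow> c * (norm v)\<^sup>2 \<le> norm (rho (gexp v))"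
  shows "rho_asymp \<nu> \<nu>' H 1"
proof (rule rho_asympI[OF \<nu> \<nu>' closed_subspace[OF S] H])
  \<comment> \<open>Entries are bounded by 7/2 and minors by 8 + 6 = 14 times the squared norm; 20
    is a round number above both.\<close>
  define C where "C = max 20 (1 / c)"
  show "C > 0" by (simp add: C_def)
  have C: "20 \<le> C" "1 / c \<le> C" by (simp_all add: C_def)
  have inv_c: "a \<le> C * b" if "c * a \<le> b" "b \<ge> 0" for a b
  proof -
    have "a \<le> (1 / c) * b" using that(1) c by (simp add: field_simps)
    also have "\<dots> \<le> C * b" using C(2) that(2) by (rule mult_right_mono)
    finally show ?thesis .
  qed
  fix v assume v: "v \<in> S" "norm v \<ge> 1"
  define n where "n = norm v"
  have n: "n \<ge> 1" "n \<le> n\<^sup>2" "1 \<le> n\<^sup>2"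
    using v(2) by (simp_all add: n_def self_le_power)
  have g: "gexp v = mat 1 + nil v + (1/2) *\<^sub>R gquad v"
    by (simp add: gexp_def cub[OF v(1)])
  have one: "\<bar>mat 1 $ i $ j\<bar> \<le> (1::real)" for i j :: "'k idx" by (simp add: mat_def)
  have A: "\<bar>nil v $ i $ j\<bar> \<le> n" for i j unfolding n_def by (rule nil_le_norm)
  have Q: "\<bar>gquad v $ i $ j\<bar> \<le> 3 * n\<^sup>2" for i j unfolding n_def by (rule gquad_le_norm)
  have A1: "\<bar>(mat 1 + nil v) $ i $ j\<bar> \<le> 2 * n" for i j
    using one[of i j] A[of i j] n(1) by simp
  show "0 \<le> (norm v)\<^sup>2" by simp
  show "(norm v)\<^sup>2 \<le> C * norm (gexp v)" by (rule inv_c[OF g_lower[OF v(1)]]) simp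
  show "(norm v)\<^sup>2 powr 1 \<le> C * norm (rho (gexp v))"
    using inv_c[OF rho_lower[OF v(1)]] by simp
  fix i j
  have "\<bar>gexp v $ i $ j\<bar> \<le> 20 * n\<^sup>2"
    using A1[of i j] Q[of i j] n(2) by (simp add: g)
  also have "\<dots> \<le> C * n\<^sup>2" using C(1) by (rule mult_right_mono) simp
  finally show "\<bar>gexp v $ i $ j\<bar> \<le> C * (norm v)\<^sup>2" by (simp add: n_def)
  fix k l
  have MX: "\<bar>mat 1 $ a $ b * gquad v $ a' $ b'\<bar> \<le> 3 * n\<^sup>2" for a b :: "'k idx" and a' b'
    using mult_mono[OF one[of a b] Q[of a' b']] by (simp add: abs_mult)
  have "minor (gexp v) i k j l = minor (mat 1 + nil v) i k j l + (1/2) * minor2 (mat 1) (gquad v) i k j l"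
    unfolding g minor_expand by (simp add: mixed[OF v(1)] quad[OF v(1)])
  moreover have "\<bar>minor (mat 1 + nil v) i k j l\<bar> \<le> 2 * (2 * n)\<^sup>2"
    by (rule minor_le[OF A1])
  moreover have "\<bar>minor2 (mat 1) (gquad v) i k j l\<bar> \<le> 4 * (3 * n\<^sup>2)"
    using MX[of i j k l] MX[of k l i j] MX[of i l k j] MX[of k j i l]
    unfolding minor2_def mult.commute[of "gquad v $ _ $ _"] by linarith
  ultimately have "\<bar>minor (gexp v) i k j l\<bar> \<le> 20 * n\<^sup>2" by (simp add: power_mult_distrib)
  also have "\<dots> \<le> C * n\<^sup>2" using C(1) by (rule mult_right_mono) simp
  finally show "\<bar>minor (gexp v) i k j l\<bar> \<le> C * (norm v)\<^sup>2 powr 1" by (simp add: n_def)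
qed simp

text \<open>For y = 0 the square is concentrated in the upper right corner. Its partner in a minor
  lies outside the first row and the last column, where \<open>nil\<close> vanishes.\<close>

lemma minor2_nil_gquad_y0: "minor2 (nil (\<phi>, x, 0, \<eta>)) (gquad (\<phi>, x, 0, \<eta>)) i k j l = 0"
proof -
  have "gquad (\<phi>, x, 0, \<eta>) $ a $ b = 0" if "a \<noteq> First \<or> b \<noteq> Last" for a b
    using that by (cases a; cases b) (auto simp: gquad_def)
  moreover have "nil (\<phi>, x, 0, \<eta>) $ a $ b = 0" if "a \<noteq> First" "b \<noteq> Last" for a b
    using that by (cases a; cases b) (auto simp: nil_def nil_mat_def)
  ultimately show ?thesis
    unfolding minor2_def
    by (cases "i = First"; cases "k = First"; cases "j = Last"; cases "l = Last") simp_all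
qed

lemma minor_gquad_y0: "minor (gquad (\<phi>, x, 0, \<eta>)) i k j l = 0"
proof -
  have "gquad (\<phi>, x, 0, \<eta>) $ a $ b = 0" if "a \<noteq> First \<or> b \<noteq> Last" for a b
    using that by (cases a; cases b) (auto simp: gquad_def)
  then show ?thesis
    unfolding minor_def
    by (cases "i = First"; cases "k = First"; cases "j = Last"; cases "l = Last") simp_all
qed

text \<open>Hypothesis \<open>q\<close> says that the corner entry has no nontrivial zero on
  \<open>S\<close>, so its absolute value is bounded below by a multiple of the squared
  norm.\<close>

lemma rho_asymp_1_y0:
  fixes S :: "'k::{finite,linorder} coord set"
  assumes \<nu>: "is_norm \<nu>" and \<nu>': "is_norm \<nu>'" and S: "subspace S" and H: "H = gexp ` S"
    and y: "\<And>\<phi> x y \<eta>. (\<phi>, x, y, \<eta>) \<in> S \<Longrightarrow> y = 0"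
    and q: "\<And>\<phi> x \<eta>. (\<phi>, x, 0, \<eta>) \<in> S \<Longrightarrow> \<phi> * \<eta> + x \<bullet> x / 2 = 0 \<Longrightarrow> \<phi> = 0 \<and> x = 0 \<and> \<eta> = 0"
  shows "rho_asymp \<nu> \<nu>' H 1"
proof -
  define f :: "'k coord \<Rightarrow> real" where
    "f v = \<bar>fst v * snd (snd (snd v)) + fst (snd v) \<bullet> fst (snd v) / 2\<bar>" for v
  have "continuous_on S f" unfolding f_def by (intro continuous_intros) simp
  moreover have "f (t *\<^sub>R v) = \<bar>t\<bar> ^ 2 * f v" for t v
  proof -
    have "f (t *\<^sub>R v) = \<bar>t\<^sup>2 * (fst v * snd (snd (snd v)) + fst (snd v) \<bullet> fst (snd v) / 2)\<bar>"
      by (simp add: f_def power2_eq_square algebra_simps)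
    then show ?thesis by (simp only: abs_mult f_def) simp
  qed
  moreover have "f v > 0" if "v \<in> S" "v \<noteq> 0" for v
    using that y q by (cases v) (force simp: f_def zero_prod_def)
  ultimately obtain c where c: "c > 0" "\<And>v. v \<in> S \<Longrightarrow> c * norm v ^ 2 \<le> f v"
    by (rule homogeneous_lower_bound[OF S _ pos2, of f]) blast+
  show ?thesis
  proof (rule rho_asymp_1I[OF \<nu> \<nu>' S H, of "min c (1/4)"])
    show "min c (1/4) > 0" using c(1) by simp
    fix v assume "v \<in> S"
    then obtain \<phi> x \<eta> where v: "v = (\<phi>, x, 0, \<eta>)" using y by (cases v) blast
    show "gcub v = 0" "gquart v = 0"
      by (auto simp: v gcub_def gquart_def vec_eq_iff split: idx.split)
    show "minor2 (nil v) (gquad v) i k j l = 0" "minor (gquad v) i k j l = 0" for i k j l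
      unfolding v by (rule minor2_nil_gquad_y0 minor_gquad_y0)+
    have min: "min c (1/4) * (norm v)\<^sup>2 \<le> a * (norm v)\<^sup>2" if "min c (1/4) \<le> a" for a
      using that by (rule mult_right_mono) simp
    have "f v = \<bar>gexp v $ First $ Last\<bar>"
      unfolding v gexp_entries by (simp add: f_def)
    then have "f v \<le> norm (gexp v)" by (simp only: entry_le_norm)
    then show "min c (1/4) * (norm v)\<^sup>2 \<le> norm (gexp v)"
      using min[of c] c(2)[OF \<open>v \<in> S\<close>] by simp
    \<comment> \<open>The products of phi and eta cancel here, so these three minors together
      control the squared norm for every element with y = 0.\<close>
    have "minor (gexp v) First Second Second Last = x \<bullet> x / 2"
      "minor (gexp v) First Second Penult Last = - (\<eta>\<^sup>2)"
      "minor (gexp v) First Penult Second Last = - (\<phi>\<^sup>2)"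
      unfolding v gexp_entries minor_def by (simp_all add: power2_eq_square)
    with minor_le_norm_rho[OF idx_less(1,3), of "gexp v"] minor_le_norm_rho[OF idx_less(1,4), of "gexp v"]
      minor_le_norm_rho[OF idx_less(2,3), of "gexp v"]
    have "x \<bullet> x + \<eta>\<^sup>2 + \<phi>\<^sup>2 \<le> 4 * norm (rho (gexp v))" by simp
    then have "1/4 * (norm v)\<^sup>2 \<le> norm (rho (gexp v))" by (simp add: v norm_coord)
    then show "min c (1/4) * (norm v)\<^sup>2 \<le> norm (rho (gexp v))"
      using min[of "1/4"] by linarith
  qed
qed

text \<open>For proportional x and y the square is the rank-one matrix with entries
  \<open>- (u \<bullet> u) * (P i * Q j)\<close>, so its minors vanish.\<close>

lemma minor2_nil_gquad_phi0:
  fixes u :: "real ^ 'k::finite" and a b \<eta> :: real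
  defines "v \<equiv> (0, a *\<^sub>R u, b *\<^sub>R u, \<eta>)"
  shows "minor2 (nil v) (gquad v) i k j l = 0" "minor (gquad v) i k j l = 0"
proof -
  define P :: "'k idx \<Rightarrow> real" where "P i = (case i of First \<Rightarrow> a | Second \<Rightarrow> b | _ \<Rightarrow> 0)" for i
  define Q :: "'k idx \<Rightarrow> real" where "Q j = (case j of Penult \<Rightarrow> b | Last \<Rightarrow> a | _ \<Rightarrow> 0)" for j
  define B where "B j = (case j of Mid c \<Rightarrow> u $ c | _ \<Rightarrow> 0)" for j
  define w where "w j l = B j * Q l - B l * Q j
    + (case (j, l) of (Penult, Last) \<Rightarrow> \<eta> | (Last, Penult) \<Rightarrow> - \<eta> | _ \<Rightarrow> 0)" for j l
  have gq: "gquad v $ i $ j = - (u \<bullet> u) * (P i * Q j)" for i j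
    unfolding v_def by (cases i; cases j) (simp_all add: gquad_def P_def Q_def)
  show "minor (gquad v) i k j l = 0" by (simp add: minor_def gq)
  \<comment> \<open>Wedging the rows of \<open>nil v\<close> with \<open>Q\<close> again yields
    multiples of a single form \<open>w\<close>, with the same coefficients \<open>P\<close>; the
    middle rows are multiples of \<open>Q\<close> and drop out. The mixed minor becomes
    \<open>P k * P i - P i * P k\<close> times \<open>w\<close>.\<close>
  have W: "nil v $ i $ j * Q l - nil v $ i $ l * Q j = P i * w j l" for i j l
    unfolding v_def
    by (cases i; cases j; cases l) (simp_all add: nil_def nil_mat_def P_def Q_def B_def w_def)
  have "minor2 (nil v) (gquad v) i k j l = - (u \<bullet> u) * (P k * (nil v $ i $ j * Q l - nil v $ i $ l * Q j)
      - P i * (nil v $ k $ j * Q l - nil v $ k $ l * Q j))"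
    by (simp add: minor2_def gq algebra_simps)
  then show "minor2 (nil v) (gquad v) i k j l = 0" unfolding W by simp
qed

lemma Cauchy_Schwarz_eq_imp_common_line:
  fixes x y :: "'a::real_inner"
  assumes "(x \<bullet> x) * (y \<bullet> y) = (x \<bullet> y)\<^sup>2"
  obtains u a b where "x = a *\<^sub>R u" "y = b *\<^sub>R u"
proof (cases "x = 0")
  case True then show ?thesis using that[of 0 y 1] by simp
next
  case False
  define b where "b = (x \<bullet> y) / (x \<bullet> x)"
  have "(y - b *\<^sub>R x) \<bullet> (y - b *\<^sub>R x) = y \<bullet> y - 2 * b * (x \<bullet> y) + b * b * (x \<bullet> x)"
    by (simp add: inner_simps inner_commute algebra_simps)
  also have "\<dots> = y \<bullet> y - (x \<bullet> y)\<^sup>2 / (x \<bullet> x)"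
    using False by (simp add: b_def power2_eq_square)
  also have "\<dots> = 0" using False assms by (simp add: field_simps)
  finally have "y = b *\<^sub>R x" by simp
  then show ?thesis using that[of 1 x b] by simp
qed

text \<open>Hypothesis \<open>z\<close> excludes elements with only eta, whose entries are linear
  but which have the minor -eta^2. Without them |x|^2 + |y|^2 is positive on nonzero elements of
  \<open>S\<close>.\<close>

lemma rho_asymp_1_phi0:
  fixes S :: "'k::{finite,linorder} coord set"
  assumes \<nu>: "is_norm \<nu>" and \<nu>': "is_norm \<nu>'" and S: "subspace S" and H: "H = gexp ` S"
    and \<phi>: "\<And>\<phi> x y \<eta>. (\<phi>, x, y, \<eta>) \<in> S \<Longrightarrow> \<phi> = 0 \<and> (x \<bullet> x) * (y \<bullet> y) = (x \<bullet> y)\<^sup>2"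
    and z: "\<And>\<eta>. (0, 0, 0, \<eta>) \<in> S \<Longrightarrow> \<eta> = 0"
  shows "rho_asymp \<nu> \<nu>' H 1"
proof -
  define f :: "'k coord \<Rightarrow> real" where
    "f v = fst (snd v) \<bullet> fst (snd v) + fst (snd (snd v)) \<bullet> fst (snd (snd v))" for v
  have "continuous_on S f" unfolding f_def by (intro continuous_intros)
  moreover have "f (t *\<^sub>R v) = \<bar>t\<bar> ^ 2 * f v" for t v
    by (simp add: f_def power2_eq_square algebra_simps)
  moreover have "f v > 0" if v: "v \<in> S" "v \<noteq> 0" for v
  proof -
    obtain x y \<eta> where e: "v = (0, x, y, \<eta>)" using v(1) \<phi> by (cases v) blast
    then have "x \<noteq> 0 \<or> y \<noteq> 0" using v z by (auto simp: zero_prod_def)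
    then show ?thesis
      by (auto simp: e f_def intro: add_pos_nonneg add_nonneg_pos)
  qed
  ultimately obtain c where c: "c > 0" "\<And>v. v \<in> S \<Longrightarrow> c * norm v ^ 2 \<le> f v"
    by (rule homogeneous_lower_bound[OF S _ pos2, of f]) blast+
  show ?thesis
  proof (rule rho_asymp_1I[OF \<nu> \<nu>' S H, of "c/4"])
    show "c/4 > 0" using c(1) by simp
    fix v assume "v \<in> S"
    then obtain x y \<eta> where v: "v = (0, x, y, \<eta>)" and gram: "(x \<bullet> x) * (y \<bullet> y) = (x \<bullet> y)\<^sup>2"
      using \<phi> by (cases v) blast
    obtain u a b where xy: "x = a *\<^sub>R u" "y = b *\<^sub>R u"
      using Cauchy_Schwarz_eq_imp_common_line[OF gram] .
    show "gcub v = 0" "gquart v = 0"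
      by (auto simp: v gcub_def gquart_def vec_eq_iff split: idx.split)
    show "minor2 (nil v) (gquad v) i k j l = 0" "minor (gquad v) i k j l = 0" for i k j l
      unfolding v xy by (rule minor2_nil_gquad_phi0)+
    have low: "c/4 * (norm v)\<^sup>2 \<le> r" if "x \<bullet> x \<le> 2 * r" "y \<bullet> y \<le> 2 * r" for r
      using c(2)[OF \<open>v \<in> S\<close>] that by (simp add: v f_def)
    show "c/4 * (norm v)\<^sup>2 \<le> norm (gexp v)"
      using entry_le_norm[of "gexp v" First Last] entry_le_norm[of "gexp v" Second Penult]
      by (intro low) (simp_all add: v gexp_entries)
    have "minor (gexp v) First Second Second Last = x \<bullet> x / 2"
      "minor (gexp v) First Second First Penult = - (y \<bullet> y / 2)"
      unfolding v gexp_entries minor_def by simp_all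
    with minor_le_norm_rho[OF idx_less(1,3), of "gexp v"] minor_le_norm_rho[OF idx_less(1,2), of "gexp v"]
    show "c/4 * (norm v)\<^sup>2 \<le> norm (rho (gexp v))"
      by (intro low) simp_all
  qed
qed

section \<open>Subgroups with exponent 2\<close>

text \<open>Since x, y enter the largest entries quadratically and eta linearly, the right size is
  \<open>M\<close> = |x|^2 + |y|^2 + |eta| rather than a power of the norm.\<close>

lemma rho_asymp_2_phi0:
  fixes S :: "'k::{finite,linorder} coord set"
  assumes \<nu>: "is_norm \<nu>" and \<nu>': "is_norm \<nu>'" and S: "subspace S" and H: "H = gexp ` S"
    and \<phi>: "\<And>\<phi> x y \<eta>. (\<phi>, x, y, \<eta>) \<in> S \<Longrightarrow> \<phi> = 0"
    and gram: "\<And>x y \<eta>. (0, x, y, \<eta>) \<in> S \<Longrightarrow> (x \<bullet> x) * (y \<bullet> y) = (x \<bullet> y)\<^sup>2 \<Longrightarrow> x = 0 \<and> y = 0"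
  shows "rho_asymp \<nu> \<nu>' H 2"
proof -
  \<comment> \<open>Eta is projected away because the Gram determinant, homogeneous of degree 4, is
    positive only as a function of the pair (x, y).\<close>
  define p :: "'k coord \<Rightarrow> (real, 'k) vec \<times> (real, 'k) vec" where "p v = (fst (snd v), fst (snd (snd v)))" for v
  have "linear p" by (intro linearI) (simp_all add: p_def)
  then have pS: "subspace (p ` S)" using S by (rule linear_subspace_image)
  define f :: "(real, 'k) vec \<times> (real, 'k) vec \<Rightarrow> real" where
    "f z = (fst z \<bullet> fst z) * (snd z \<bullet> snd z) - (fst z \<bullet> snd z)\<^sup>2" for z
  have "continuous_on (p ` S) f" unfolding f_def by (intro continuous_intros)
  moreover have "f (t *\<^sub>R z) = \<bar>t\<bar> ^ 4 * f z" for t z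
    by (simp add: f_def power2_eq_square power4_eq_xxxx algebra_simps)
  moreover have "f z > 0" if z: "z \<in> p ` S" "z \<noteq> 0" for z
  proof -
    obtain x y \<eta> where e: "z = (x, y)" "(0, x, y, \<eta>) \<in> S" using z(1) \<phi> by (force simp: p_def)
    have "f z \<ge> 0" using Cauchy_Schwarz_ineq[of x y] by (simp add: f_def e(1))
    moreover have "f z \<noteq> 0" using gram[OF e(2)] z(2) by (auto simp: f_def e(1) zero_prod_def)
    ultimately show ?thesis by simp
  qed
  ultimately obtain c where c: "c > 0" "\<And>z. z \<in> p ` S \<Longrightarrow> c * norm z ^ 4 \<le> f z"
    by (rule homogeneous_lower_bound[OF pS _ zero_less_numeral, of f]) blast+
  define M :: "'k coord \<Rightarrow> real" where
    "M v = fst (snd v) \<bullet> fst (snd v) + fst (snd (snd v)) \<bullet> fst (snd (snd v)) + \<bar>snd (snd (snd v))\<bar>" for v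
  \<comment> \<open>With g the Gram determinant and c m^2 <= g, the sum 2 m^2 + 2 eta^2 is at most 2
    + 8 / c times eta^2 + g / 4.\<close>
  define C where "C = max 20 (2 + 8 / c)"
  have C: "20 \<le> C" "2 + 8 / c \<le> C" by (simp_all add: C_def)
  show ?thesis
  proof (rule rho_asympI[OF \<nu> \<nu>' closed_subspace[OF S] H, of 2 C 2 M])
    show "C > 0" using C(1) by simp
    fix v assume vS: "v \<in> S" and v2: "2 \<le> norm v"
    then obtain x y \<eta> where v: "v = (0, x, y, \<eta>)" using \<phi> by (cases v) blast
    define m where "m = x \<bullet> x + y \<bullet> y"
    have M: "M v = m + \<bar>\<eta>\<bar>" by (simp add: M_def v m_def)
    have m0: "x \<bullet> x \<ge> 0" "y \<bullet> y \<ge> 0" "m \<ge> 0" by (simp_all add: m_def)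
    have M1: "M v \<ge> 1"
    proof (rule ccontr)
      assume "\<not> 1 \<le> M v"
      then have "m < 1" "\<bar>\<eta>\<bar> < 1" using m0 by (simp_all add: M)
      moreover have "\<eta>\<^sup>2 < 1" using \<open>\<bar>\<eta>\<bar> < 1\<close> by (simp add: abs_square_less_1)
      moreover have "(norm v)\<^sup>2 = m + \<eta>\<^sup>2" unfolding v norm_coord m_def by simp
      moreover have "(2::real)\<^sup>2 \<le> (norm v)\<^sup>2" using v2 by (intro power_mono) auto
      ultimately show False by simp
    qed
    then show "0 \<le> M v" by simp
    have M2: "M v powr 2 = (M v)\<^sup>2" using M1 by simp
    have comp: "\<bar>z $ b\<bar> \<le> 1 + z \<bullet> z" for z :: "(real, 'k) vec" and b
    proof -
      have "\<bar>z $ b\<bar> \<le> norm z" by (rule component_le_norm_cart)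
      also have "norm z \<le> 1 + (norm z)\<^sup>2"
        using zero_le_power2[of "norm z - 1/2"] by (simp add: power2_eq_square algebra_simps)
      finally show ?thesis by (simp add: power2_norm_eq_inner)
    qed
    have xy: "\<bar>x \<bullet> y\<bar> \<le> m"
    proof -
      have "0 \<le> (x + y) \<bullet> (x + y)" "0 \<le> (x - y) \<bullet> (x - y)" by simp_all
      then show ?thesis using m0 by (simp add: inner_simps inner_commute m_def)
    qed
    have dom: "p \<le> 2 * (X + Y + e)" if "p \<le> 1 + X \<or> p \<le> 1 + Y" "0 \<le> X" "0 \<le> Y" "0 \<le> e" "1 \<le> X + Y + e"
      for p X Y e :: real using that(1) by (rule disjE) (use that(2-) in simp)+
    have "\<bar>x $ b\<bar> \<le> 2 * M v" "\<bar>y $ b\<bar> \<le> 2 * M v" for b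
      using comp[of x b] comp[of y b] M1 unfolding M m_def by (intro dom; simp)+
    then have ent: "\<bar>gexp v $ i $ j\<bar> \<le> 2 * M v" for i j
      using M1 m0 xy unfolding v gexp_entries M[unfolded v]
      by (cases i; cases j) (auto simp: m_def)
    have MC: "2 * M v \<le> C * M v" using C(1) M1 by (intro mult_right_mono) auto
    show "\<bar>gexp v $ i $ j\<bar> \<le> C * M v" for i j using ent MC by (rule order_trans)
    have "\<bar>minor (gexp v) i r j s\<bar> \<le> 2 * (2 * M v)\<^sup>2" for i r j s by (rule minor_le[OF ent])
    moreover have "2 * (2 * M v)\<^sup>2 \<le> C * M v powr 2"
      using C(1) mult_right_mono[of 8 C "(M v)\<^sup>2"] by (simp add: M2 power_mult_distrib)
    ultimately show "\<bar>minor (gexp v) i r j s\<bar> \<le> C * M v powr 2" for i r j s by (rule order_trans)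
    have "M v \<le> 20 * norm (gexp v)"
    proof -
      define N where "N = norm (gexp v)"
      have e: "\<bar>gexp v $ First $ Last\<bar> \<le> N" "\<bar>gexp v $ Second $ Penult\<bar> \<le> N"
        "\<bar>gexp v $ First $ Penult\<bar> \<le> N" "\<bar>gexp v $ Second $ Last\<bar> \<le> N"
        unfolding N_def by (rule entry_le_norm)+
      \<comment> \<open>The last two entries differ by 2 eta, which isolates eta from the inner
        product.\<close>
      have "\<bar>x \<bullet> x / 2\<bar> \<le> N" "\<bar>y \<bullet> y / 2\<bar> \<le> N" "\<bar>\<eta> - x \<bullet> y / 2\<bar> \<le> N" "\<bar>- \<eta> - x \<bullet> y / 2\<bar> \<le> N"
        using e unfolding v gexp_entries by simp_all
      then show ?thesis unfolding M m_def N_def[symmetric] by (simp add: abs_if split: if_splits)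
    qed
    also have "\<dots> \<le> C * norm (gexp v)" using C(1) by (intro mult_right_mono) auto
    finally show "M v \<le> C * norm (gexp v)" .
    define g where "g = (x \<bullet> x) * (y \<bullet> y) - (x \<bullet> y)\<^sup>2"
    have "p v \<in> p ` S" using vS by blast
    moreover have "(norm (x, y))\<^sup>2 = m" by (simp add: norm_Pair power2_norm_eq_inner m_def)
    then have "norm (x, y) ^ 4 = m\<^sup>2" using power_mult[of "norm (x, y)" 2 2] by simp
    ultimately have "c * m\<^sup>2 \<le> g"
      using c(2)[of "p v"] by (simp add: v p_def f_def g_def)
    then have mg: "m\<^sup>2 \<le> g / c" using c(1) by (simp add: field_simps)
    have g0: "g \<ge> 0" using Cauchy_Schwarz_ineq[of x y] by (simp add: g_def)
    have min: "minor (gexp v) First Second Penult Last = - (\<eta>\<^sup>2 + g / 4)"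
      unfolding v gexp_entries minor_def g_def by (simp add: power2_eq_square field_simps)
    have "(M v)\<^sup>2 \<le> 2 * m\<^sup>2 + 2 * \<eta>\<^sup>2"
      using zero_le_power2[of "m - \<bar>\<eta>\<bar>"] by (simp add: M power2_sum power2_diff)
    also have "\<dots> \<le> (2 + 8 / c) * (\<eta>\<^sup>2 + g / 4)"
    proof -
      have "2 * m\<^sup>2 \<le> 2 * g / c" using mg by simp
      moreover have "0 \<le> g / 2 + 8 * \<eta>\<^sup>2 / c" using g0 c(1) by simp
      ultimately show ?thesis by (simp add: algebra_simps)
    qed
    also have "\<dots> \<le> C * (\<eta>\<^sup>2 + g / 4)" using C(2) g0 by (intro mult_right_mono) auto
    also have "\<dots> \<le> C * norm (rho (gexp v))"
      using minor_le_norm_rho[OF idx_less(1,4), of "gexp v"] g0 C(1)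
      by (intro mult_left_mono) (simp_all add: min)
    finally show "M v powr 2 \<le> C * norm (rho (gexp v))" by (simp only: M2)
  qed simp
qed

text \<open>The degenerate case: the corner entry vanishes, so \<open>gquad v\<close> does too and
  \<open>gexp v\<close> is affine in \<open>v\<close>. By \<open>z\<close>, phi alone controls the
  norm, and the minor -phi^2 has full size.\<close>

lemma rho_asymp_2_y0:
  fixes S :: "'k::{finite,linorder} coord set"
  assumes \<nu>: "is_norm \<nu>" and \<nu>': "is_norm \<nu>'" and S: "subspace S" and H: "H = gexp ` S"
    and y: "\<And>\<phi> x y \<eta>. (\<phi>, x, y, \<eta>) \<in> S \<Longrightarrow> y = 0 \<and> \<phi> * \<eta> + x \<bullet> x / 2 = 0"
    and z: "\<And>x y \<eta>. (0, x, y, \<eta>) \<in> S \<Longrightarrow> x = 0 \<and> \<eta> = 0"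
  shows "rho_asymp \<nu> \<nu>' H 2"
proof -
  define f :: "'k coord \<Rightarrow> real" where "f v = \<bar>fst v\<bar>" for v
  have "continuous_on S f" unfolding f_def by (intro continuous_intros)
  moreover have "f (t *\<^sub>R v) = \<bar>t\<bar> ^ 1 * f v" for t v by (simp add: f_def abs_mult)
  moreover have "f v > 0" if v: "v \<in> S" "v \<noteq> 0" for v
    using v y z by (cases v) (force simp: f_def zero_prod_def)
  ultimately obtain c where c: "c > 0" "\<And>v. v \<in> S \<Longrightarrow> c * norm v ^ 1 \<le> f v"
    by (rule homogeneous_lower_bound[OF S _ zero_less_one, of f]) blast+
  define C where "C = max 20 (max (1 / c) ((1 / c)\<^sup>2))"
  have C: "20 \<le> C" "1 / c \<le> C" "(1 / c)\<^sup>2 \<le> C" by (simp_all add: C_def)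
  show ?thesis
  proof (rule rho_asympI[OF \<nu> \<nu>' closed_subspace[OF S] H, of 2 C 1 norm])
    show "C > 0" using C(1) by simp
    fix v assume vS: "v \<in> S" and v1: "1 \<le> norm v"
    then obtain \<phi> x \<eta> where v: "v = (\<phi>, x, 0, \<eta>)" and q: "\<phi> * \<eta> + x \<bullet> x / 2 = 0"
      using y by (cases v) blast
    show "0 \<le> norm v" by simp
    have q': "2 * \<phi> * \<eta> = - (x \<bullet> x)" using q by simp
    have "gquad v $ i $ j = 0" for i j
      by (cases i; cases j) (auto simp: v gquad_def q')
    then have "gquad v = 0" by (simp add: vec_eq_iff)
    moreover have "gcub v = 0" "gquart v = 0"
      by (auto simp: v gcub_def gquart_def vec_eq_iff split: idx.split)
    ultimately have g: "gexp v = mat 1 + nil v" by (simp add: gexp_def)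
    have one: "\<bar>mat 1 $ i $ j\<bar> \<le> (1::real)" for i j :: "'k idx" by (simp add: mat_def)
    have ent: "\<bar>gexp v $ i $ j\<bar> \<le> 2 * norm v" for i j
      using one[of i j] nil_le_norm[of v i j] v1 unfolding g vector_add_component by linarith
    have "2 * norm v \<le> C * norm v" using C(1) by (intro mult_right_mono) auto
    then show "\<bar>gexp v $ i $ j\<bar> \<le> C * norm v" for i j using ent order_trans by blast
    have M2: "norm v powr 2 = (norm v)\<^sup>2" by simp
    have "\<bar>minor (gexp v) i r j s\<bar> \<le> 2 * (2 * norm v)\<^sup>2" for i r j s by (rule minor_le[OF ent])
    moreover have "2 * (2 * norm v)\<^sup>2 \<le> C * norm v powr 2"
      using C(1) mult_right_mono[of 8 C "(norm v)\<^sup>2"] by (simp add: M2 power_mult_distrib)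
    ultimately show "\<bar>minor (gexp v) i r j s\<bar> \<le> C * norm v powr 2" for i r j s by (rule order_trans)
    have n\<phi>: "norm v \<le> 1 / c * \<bar>\<phi>\<bar>" using c(2)[OF vS] c(1) by (simp add: f_def v field_simps)
    also have "\<bar>\<phi>\<bar> \<le> norm (gexp v)"
      using entry_le_norm[of "gexp v" First Second] by (simp add: v gexp_entries)
    then have "1 / c * \<bar>\<phi>\<bar> \<le> C * norm (gexp v)" using C(1,2) by (intro mult_mono) auto
    finally show "norm v \<le> C * norm (gexp v)" .
    have "(norm v)\<^sup>2 \<le> (1 / c * \<bar>\<phi>\<bar>)\<^sup>2" using n\<phi> by (rule power_mono) simp
    also have "\<dots> = (1 / c)\<^sup>2 * \<phi>\<^sup>2" by (simp add: power_mult_distrib power_divide)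
    also have "minor (gexp v) First Penult Second Last = - (\<phi>\<^sup>2)"
      using q unfolding v gexp_entries minor_def by (simp add: power2_eq_square)
    then have "\<phi>\<^sup>2 \<le> norm (rho (gexp v))"
      using minor_le_norm_rho[OF idx_less(2,3), of "gexp v"] by simp
    then have "(1 / c)\<^sup>2 * \<phi>\<^sup>2 \<le> C * norm (rho (gexp v))" using C(1,3) by (intro mult_mono) auto
    finally show "norm v powr 2 \<le> C * norm (rho (gexp v))" by (simp only: M2)
  qed simp
qed

section \<open>Lines with exponent 3/2\<close>

text \<open>In this grading phi and y raise the weight by 1, x by 2 and eta by 3. Along a line the
  top powers of t therefore involve only phi and y.\<close>

fun wt :: "'k idx \<Rightarrow> nat" where
  "wt First = 0" | "wt Second = 1" | "wt (Mid a) = 2" | "wt Penult = 3" | "wt Last = 4"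

lemma gexp_scaleR:
  "gexp (t *\<^sub>R v) = mat 1 + t *\<^sub>R nil v + (t\<^sup>2 / 2) *\<^sub>R gquad v + (t ^ 3 / 6) *\<^sub>R gcub v + (t ^ 4 / 24) *\<^sub>R gquart v"
proof -
  have "gexp (t *\<^sub>R v) $ i $ j = (mat 1 + t *\<^sub>R nil v + (t\<^sup>2 / 2) *\<^sub>R gquad v + (t ^ 3 / 6) *\<^sub>R gcub v
      + (t ^ 4 / 24) *\<^sub>R gquart v) $ i $ j" for i j
    by (cases v; cases i; cases j)
      (simp_all add: gexp_def g_defs power2_eq_square power3_eq_cube power4_eq_xxxx algebra_simps
        add_divide_distrib diff_divide_distrib)
  then show ?thesis by (simp add: vec_eq_iff)
qed

text \<open>With the grading \<open>wt\<close>, each factor of \<open>nil v\<close> raises the weight by at least one.\<close>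

lemma gexp_weight_bound:
  obtains K where "K > 0"
    "\<And>t i j. \<bar>t\<bar> \<ge> 1 \<Longrightarrow> \<bar>gexp (t *\<^sub>R v) $ i $ j\<bar> * \<bar>t\<bar> ^ wt i \<le> K * \<bar>t\<bar> ^ wt j"
proof -
  define K where "K = 1 + norm (nil v) + norm (gquad v) + norm (gcub v) + norm (gquart v)"
  have "\<bar>gexp (t *\<^sub>R v) $ i $ j\<bar> * \<bar>t\<bar> ^ wt i \<le> K * \<bar>t\<bar> ^ wt j" if t: "\<bar>t\<bar> \<ge> 1" for t i j
  proof -
    have b: "\<bar>t ^ m * A $ i $ j\<bar> * \<bar>t\<bar> ^ wt i \<le> norm A * \<bar>t\<bar> ^ wt j"
      if "A $ i $ j \<noteq> 0 \<Longrightarrow> wt i + m \<le> wt j" for A m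
    proof (cases "A $ i $ j = 0")
      case False
      have "\<bar>t ^ m * A $ i $ j\<bar> * \<bar>t\<bar> ^ wt i = \<bar>A $ i $ j\<bar> * \<bar>t\<bar> ^ (wt i + m)"
        by (simp add: abs_mult power_abs power_add)
      also have "\<dots> \<le> norm A * \<bar>t\<bar> ^ wt j"
        using t that[OF False] by (intro mult_mono entry_le_norm power_increasing) auto
      finally show ?thesis .
    qed simp
    have b0: "\<bar>mat 1 $ i $ j\<bar> * \<bar>t\<bar> ^ wt i \<le> 1 * \<bar>t\<bar> ^ wt j"
      by (simp add: mat_def)
    have b1: "\<bar>t ^ 1 * nil v $ i $ j\<bar> * \<bar>t\<bar> ^ wt i \<le> norm (nil v) * \<bar>t\<bar> ^ wt j"
      by (rule b) (cases v; cases i; cases j; simp add: nil_def nil_mat_def)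
    have b2: "\<bar>t\<^sup>2 * gquad v $ i $ j\<bar> * \<bar>t\<bar> ^ wt i \<le> norm (gquad v) * \<bar>t\<bar> ^ wt j"
      by (rule b) (cases v; cases i; cases j; simp add: gquad_def)
    have b3: "\<bar>t ^ 3 * gcub v $ i $ j\<bar> * \<bar>t\<bar> ^ wt i \<le> norm (gcub v) * \<bar>t\<bar> ^ wt j"
      by (rule b) (cases v; cases i; cases j; simp add: gcub_def)
    have b4: "\<bar>t ^ 4 * gquart v $ i $ j\<bar> * \<bar>t\<bar> ^ wt i \<le> norm (gquart v) * \<bar>t\<bar> ^ wt j"
      by (rule b) (cases v; cases i; cases j; simp add: gquart_def)
    have "\<bar>gexp (t *\<^sub>R v) $ i $ j\<bar> \<le> \<bar>mat 1 $ i $ j\<bar> + \<bar>t ^ 1 * nil v $ i $ j\<bar> + \<bar>t\<^sup>2 * gquad v $ i $ j\<bar>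
        + \<bar>t ^ 3 * gcub v $ i $ j\<bar> + \<bar>t ^ 4 * gquart v $ i $ j\<bar>"
      unfolding gexp_scaleR by simp
    then have "\<bar>gexp (t *\<^sub>R v) $ i $ j\<bar> * \<bar>t\<bar> ^ wt i \<le> (\<bar>mat 1 $ i $ j\<bar> + \<bar>t ^ 1 * nil v $ i $ j\<bar>
        + \<bar>t\<^sup>2 * gquad v $ i $ j\<bar> + \<bar>t ^ 3 * gcub v $ i $ j\<bar> + \<bar>t ^ 4 * gquart v $ i $ j\<bar>) * \<bar>t\<bar> ^ wt i"
      by (rule mult_right_mono) simp
    also have "\<dots> \<le> K * \<bar>t\<bar> ^ wt j"
      using b0 b1 b2 b3 b4 unfolding K_def distrib_right by linarith
    finally show ?thesis .
  qed
  moreover have "K > 0" unfolding K_def by (intro add_pos_nonneg) auto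
  ultimately show ?thesis using that by blast
qed

lemma cubic_lower_bound:
  fixes a b c s :: real
  assumes "s \<ge> 1" "2 * (\<bar>b\<bar> + \<bar>c\<bar>) \<le> \<bar>a\<bar> * s"
  shows "\<bar>a\<bar> / 2 * s ^ 3 \<le> \<bar>a * s ^ 3 + b * s\<^sup>2 + c * s\<bar>"
proof -
  have "\<bar>c\<bar> * s \<le> \<bar>c\<bar> * s\<^sup>2" using assms(1) by (intro mult_left_mono self_le_power) auto
  then have "\<bar>b * s\<^sup>2 + c * s\<bar> \<le> (\<bar>b\<bar> + \<bar>c\<bar>) * s\<^sup>2"
    using abs_triangle_ineq[of "b * s\<^sup>2" "c * s"] assms(1) by (simp add: abs_mult algebra_simps)
  also have "\<dots> \<le> \<bar>a\<bar> * s / 2 * s\<^sup>2" using assms by (intro mult_right_mono) auto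
  finally have "\<bar>b * s\<^sup>2 + c * s\<bar> \<le> \<bar>a\<bar> / 2 * s ^ 3" by (simp add: power3_eq_cube power2_eq_square mult_ac)
  moreover have "\<bar>a * s ^ 3\<bar> = \<bar>a\<bar> * s ^ 3" using assms(1) by (simp add: abs_mult)
  ultimately show ?thesis by linarith
qed

lemma rho_asymp_3_2:
  fixes S :: "'k::{finite,linorder} coord set"
  assumes \<nu>: "is_norm \<nu>" and \<nu>': "is_norm \<nu>'" and H: "H = gexp ` S"
    and S: "S = span {(\<phi>, x, y, \<eta>)}" and \<phi>: "\<phi> \<noteq> 0" and y: "y \<noteq> 0"
  shows "rho_asymp \<nu> \<nu>' H (3/2)"
proof -
  define v0 where "v0 = (\<phi>, x, y, \<eta>)"
  have v0: "norm v0 > 0" using \<phi> by (simp add: v0_def zero_prod_def)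
  define r where "r v = norm v / norm v0" for v :: "'k coord"
  define Y where "Y = y \<bullet> y"
  have Y: "Y > 0" using y by (simp add: Y_def)
  obtain K where K: "K > 0"
    "\<And>t i j. \<bar>t\<bar> \<ge> 1 \<Longrightarrow> \<bar>gexp (t *\<^sub>R v0) $ i $ j\<bar> * \<bar>t\<bar> ^ wt i \<le> K * \<bar>t\<bar> ^ wt j"
    using gexp_weight_bound[of v0] by metis
  define a1 where "a1 = \<phi>\<^sup>2 * Y / 24"
  define b1 where "b1 = - \<phi> * \<eta> - x \<bullet> x / 2"
  \<comment> \<open>Here -1/144 = -1/36 + 1/48: the leading terms of the two products in the upper
    right minor do not cancel. The other constants are the remaining coefficients, in powers of s =
    t^2, of that minor and of the corner entry.\<close>
  define a2 where "a2 = - (\<phi>\<^sup>2 * Y\<^sup>2 / 144)"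
  define b2 where "b2 = (x \<bullet> y)\<^sup>2 / 4 - \<phi> * \<eta> * Y / 6 - Y * (x \<bullet> x) / 4"
  define c2 where "c2 = - (\<eta>\<^sup>2)"
  have a: "\<bar>a1\<bar> > 0" "\<bar>a2\<bar> > 0" using \<phi> Y by (simp_all add: a1_def a2_def)
  \<comment> \<open>Beyond this multiple of \<open>norm v0\<close> the lower terms amount to at most
    half the leading one in both polynomials.\<close>
  define R where "R = max 1 (max (2 * \<bar>b1\<bar> / \<bar>a1\<bar>) (2 * (\<bar>b2\<bar> + \<bar>c2\<bar>) / \<bar>a2\<bar>))"
  have R: "1 \<le> R" "2 * \<bar>b1\<bar> / \<bar>a1\<bar> \<le> R" "2 * (\<bar>b2\<bar> + \<bar>c2\<bar>) / \<bar>a2\<bar> \<le> R"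
    unfolding R_def by (simp_all only: le_max_iff_disj order_refl simp_thms)
  define C where "C = max (max K (2 * K\<^sup>2)) (max (2 / \<bar>a1\<bar>) (2 / \<bar>a2\<bar>))"
  have C: "K \<le> C" "2 * K\<^sup>2 \<le> C" "2 / \<bar>a1\<bar> \<le> C" "2 / \<bar>a2\<bar> \<le> C" by (simp_all add: C_def)
  show ?thesis
  proof (rule rho_asympI[OF \<nu> \<nu>' _ H, of "3/2" C "R * norm v0" "\<lambda>v. r v ^ 4"])
    show "closed S" unfolding S by (rule closed_subspace[OF subspace_span])
    show "C > 0" using K(1) C(1) by simp
    fix v assume vS: "v \<in> S" and vR: "R * norm v0 \<le> norm v"
    then obtain t where v: "v = t *\<^sub>R v0" by (auto simp: S span_singleton v0_def[symmetric])
    have r: "r v = \<bar>t\<bar>" using v0 by (simp add: r_def v)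
    have tR: "R \<le> \<bar>t\<bar>" using vR v0 by (simp add: v)
    with R(1) have t1: "1 \<le> \<bar>t\<bar>" by simp
    define s where "s = t\<^sup>2"
    have "\<bar>t\<bar> \<le> \<bar>t\<bar>\<^sup>2" using t1 by (rule self_le_power) simp
    then have s: "s \<ge> 1" "R \<le> s" using tR R(1) by (simp_all add: s_def)
    have r4: "r v ^ 4 = s\<^sup>2" by (simp add: r s_def power_abs flip: power_mult)
    show "0 \<le> r v ^ 4" by (simp add: r)
    have M: "(r v ^ 4) powr (3/2) = \<bar>t\<bar> ^ 6"
    proof -
      have pw: "(u ^ 4) powr (3/2) = u ^ 6" if "u \<ge> 1" for u :: real
      proof -
        have "u ^ 4 = u powr 4" using that by simp
        then have "(u ^ 4) powr (3/2) = u powr (4 * (3/2))" by (simp only: powr_powr)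
        also have "\<dots> = u ^ 6" using that by simp
        finally show ?thesis .
      qed
      show ?thesis unfolding r by (rule pw[OF t1])
    qed
    have M': "\<bar>t\<bar> ^ 6 = s ^ 3" by (simp add: s_def power_abs flip: power_mult)
    show "\<bar>gexp v $ i $ j\<bar> \<le> C * r v ^ 4" for i j
    proof -
      have "\<bar>gexp v $ i $ j\<bar> * 1 \<le> \<bar>gexp v $ i $ j\<bar> * \<bar>t\<bar> ^ wt i"
        using t1 by (intro mult_left_mono one_le_power) auto
      also have "\<dots> \<le> K * \<bar>t\<bar> ^ wt j" unfolding v by (rule K(2)[OF t1])
      also have "\<dots> \<le> C * \<bar>t\<bar> ^ 4"
        using t1 C(1) K(1) by (intro mult_mono power_increasing) (cases j; simp)+
      finally show ?thesis by (simp add: r)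
    qed
    show "\<bar>minor (gexp v) i k j l\<bar> \<le> C * (r v ^ 4) powr (3/2)" if "i < k" "j < l" for i k j l
    proof -
      \<comment> \<open>Two distinct rows have total weight at least 0 + 1 and two distinct columns
        at most 3 + 4, so minors grow at most like the power 7 - 1 = 6 of t.\<close>
      have w: "1 \<le> wt i + wt k"
        using that(1) by (cases i; cases k; simp add: less_idx_def less_eq_idx_def)
      have w': "wt j + wt l \<le> 7"
        using that(2) by (cases j; cases l; simp add: less_idx_def less_eq_idx_def)
      have prod: "\<bar>gexp v $ i $ j * gexp v $ k $ l\<bar> \<le> K\<^sup>2 * \<bar>t\<bar> ^ 6"
        if w: "1 \<le> wt i + wt k" "wt j + wt l \<le> 7" for i j k l
      proof -
        have "\<bar>gexp v $ i $ j * gexp v $ k $ l\<bar> * \<bar>t\<bar> ^ 1 \<le> \<bar>gexp v $ i $ j * gexp v $ k $ l\<bar> * \<bar>t\<bar> ^ (wt i + wt k)"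
          using t1 w by (intro mult_left_mono power_increasing) auto
        also have "\<dots> = (\<bar>gexp v $ i $ j\<bar> * \<bar>t\<bar> ^ wt i) * (\<bar>gexp v $ k $ l\<bar> * \<bar>t\<bar> ^ wt k)"
          by (simp add: abs_mult power_add)
        also have "\<dots> \<le> (K * \<bar>t\<bar> ^ wt j) * (K * \<bar>t\<bar> ^ wt l)"
          unfolding v using K(1) by (intro mult_mono K(2)[OF t1]) auto
        also have "\<dots> = K\<^sup>2 * \<bar>t\<bar> ^ (wt j + wt l)" by (simp add: power_add power2_eq_square)
        also have "\<dots> \<le> K\<^sup>2 * \<bar>t\<bar> ^ 7" using t1 w by (intro mult_left_mono power_increasing) auto
        also have "\<dots> = (K\<^sup>2 * \<bar>t\<bar> ^ 6) * \<bar>t\<bar> ^ 1" by (simp add: eval_nat_numeral)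
        finally show ?thesis using t1 by (elim mult_right_le_imp_le) simp
      qed
      have "\<bar>minor (gexp v) i k j l\<bar> \<le> 2 * K\<^sup>2 * \<bar>t\<bar> ^ 6"
        using prod[of i k j l] prod[of i k l j] w w' unfolding minor_def by (simp add: add.commute)
      also have "\<dots> \<le> C * \<bar>t\<bar> ^ 6" using C(2) by (rule mult_right_mono) simp
      finally show ?thesis by (simp only: M)
    qed
    have e: "gexp v $ First $ Last = a1 * s\<^sup>2 + b1 * s"
      unfolding v v0_def by (simp add: gexp_entries a1_def b1_def s_def Y_def power2_eq_square power4_eq_xxxx algebra_simps
        add_divide_distrib diff_divide_distrib)
    have "2 * \<bar>b1\<bar> \<le> \<bar>a1\<bar> * R" using R(2) a(1) by (simp add: field_simps)
    also have "\<dots> \<le> \<bar>a1\<bar> * s" using s(2) by (rule mult_left_mono) simp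
    \<comment> \<open>The corner entry is only quadratic in s; an extra factor s, cancelled below,
      makes the cubic estimate apply.\<close>
    finally have "\<bar>a1\<bar> / 2 * s ^ 3 \<le> \<bar>a1 * s ^ 3 + b1 * s\<^sup>2 + 0 * s\<bar>"
      using s(1) by (intro cubic_lower_bound) simp_all
    also have "\<dots> = \<bar>s * (a1 * s\<^sup>2 + b1 * s)\<bar>" by (simp add: power3_eq_cube power2_eq_square algebra_simps)
    also have "\<dots> = s * \<bar>a1 * s\<^sup>2 + b1 * s\<bar>" using s(1) by (simp add: abs_mult)
    finally have "s * (\<bar>a1\<bar> / 2 * s\<^sup>2) \<le> s * \<bar>gexp v $ First $ Last\<bar>"
      unfolding e by (simp add: power3_eq_cube power2_eq_square mult_ac)
    then have "\<bar>a1\<bar> / 2 * s\<^sup>2 \<le> norm (gexp v)"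
      using s(1) entry_le_norm[of "gexp v" First Last] by simp
    then have "s\<^sup>2 \<le> (2 / \<bar>a1\<bar>) * norm (gexp v)" using a(1) by (simp add: field_simps)
    also have "\<dots> \<le> C * norm (gexp v)" using C(3) by (rule mult_right_mono) simp
    finally show "r v ^ 4 \<le> C * norm (gexp v)" by (simp only: r4)
    have e: "minor (gexp v) First Second Penult Last = a2 * s ^ 3 + b2 * s\<^sup>2 + c2 * s"
      unfolding v v0_def minor_def
      by (simp add: gexp_entries a2_def b2_def c2_def s_def Y_def power2_eq_square power4_eq_xxxx power3_eq_cube
        field_simps)
    have "2 * (\<bar>b2\<bar> + \<bar>c2\<bar>) \<le> \<bar>a2\<bar> * R" using R(3) a(2) by (simp add: field_simps)
    also have "\<dots> \<le> \<bar>a2\<bar> * s" using s(2) by (rule mult_left_mono) simp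
    finally have "\<bar>a2\<bar> / 2 * s ^ 3 \<le> \<bar>minor (gexp v) First Second Penult Last\<bar>"
      unfolding e using s(1) by (intro cubic_lower_bound)
    then have "\<bar>a2\<bar> / 2 * s ^ 3 \<le> norm (rho (gexp v))"
      using minor_le_norm_rho[OF idx_less(1,4), of "gexp v"] by linarith
    then have "s ^ 3 \<le> (2 / \<bar>a2\<bar>) * norm (rho (gexp v))" using a(2) by (simp add: field_simps)
    also have "\<dots> \<le> C * norm (rho (gexp v))" using C(4) by (rule mult_right_mono) simp
    finally show "(r v ^ 4) powr (3/2) \<le> C * norm (rho (gexp v))" by (simp only: M M')
  qed simp
qed

section \<open>Lines in general, and the four claims\<close>

lemma dim_le_1_imp_span:
  fixes S :: "'a::euclidean_space set"
  assumes "subspace S" "dim S \<le> 1"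
  obtains v where "S = span {v}"
proof -
  obtain B where B: "B \<subseteq> S" "independent B" "S \<subseteq> span B" "card B = dim S"
    using basis_exists by blast
  have SB: "S = span B" using B(1,3) assms(1) by (simp add: span_minimal subset_antisym)
  have "finite B" using B(2) by (rule independent_imp_finite)
  then consider "B = {}" | v where "B = {v}"
    using B(4) assms(2) by (metis card_0_eq card_1_singletonE le_Suc_eq le_zero_eq One_nat_def)
  then show ?thesis
  proof cases
    case 1 then show ?thesis using SB that[of 0] by simp
  next
    case 2 then show ?thesis using SB that by simp
  qed
qed

text \<open>Translates the rank condition of the claims into the Gram equation on which the growth
  lemmas are based.\<close>

lemma dim_pair_eq_1:
  fixes x y :: "'a::euclidean_space"
  shows "dim (span {x, y}) = 1 \<longleftrightarrow> (x \<bullet> x) * (y \<bullet> y) = (x \<bullet> y)\<^sup>2 \<and> (x \<noteq> 0 \<or> y \<noteq> 0)"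
proof
  assume d: "dim (span {x, y}) = 1"
  then obtain u where u: "span {x, y} = span {u}"
    using dim_le_1_imp_span[of "span {x, y}"] by auto
  have "x \<in> span {u}" "y \<in> span {u}" unfolding u[symmetric] by (simp_all add: span_base)
  then obtain a b where "x = a *\<^sub>R u" "y = b *\<^sub>R u" by (auto simp: span_singleton)
  moreover have "x \<noteq> 0 \<or> y \<noteq> 0" using d by auto
  ultimately show "(x \<bullet> x) * (y \<bullet> y) = (x \<bullet> y)\<^sup>2 \<and> (x \<noteq> 0 \<or> y \<noteq> 0)"
    by (simp add: power2_eq_square)
next
  assume R: "(x \<bullet> x) * (y \<bullet> y) = (x \<bullet> y)\<^sup>2 \<and> (x \<noteq> 0 \<or> y \<noteq> 0)"
  then obtain u a b where xy: "x = a *\<^sub>R u" "y = b *\<^sub>R u"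
    using Cauchy_Schwarz_eq_imp_common_line[of x y] by blast
  have "span {x, y} \<subseteq> span {u}" unfolding xy by (intro span_minimal) (auto simp: span_scale span_base)
  then have "dim (span {x, y}) \<le> dim (span {u})" by (rule dim_subset)
  also have "\<dots> \<le> 1" unfolding dim_span using dim_le_card'[of "{u}"] by simp
  finally have "dim (span {x, y}) \<le> 1" .
  moreover have "dim (span {x, y}) \<noteq> 0" unfolding dim_span dim_eq_0 using R by auto
  ultimately show "dim (span {x, y}) = 1" by linarith
qed

lemma linear_nil: "linear nil"
proof
  fix u v :: "'a coord"
  have "nil (u + v) $ i $ j = (nil u + nil v) $ i $ j" for i j
    by (cases u; cases v; cases i; cases j) (auto simp: nil_def nil_mat_def)
  then show "nil (u + v) = nil u + nil v" by (simp add: vec_eq_iff)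
qed (rule nil_scaleR)

lemma nil_eq_0: "nil v = 0 \<longleftrightarrow> v = 0"
proof
  assume v0: "nil v = 0"
  obtain \<phi> x y \<eta> where v: "v = (\<phi>, x, y, \<eta>)" by (cases v)
  have "phi_of (nil v) = 0" "x_of (nil v) = 0" "y_of (nil v) = 0" "eta_of (nil v) = 0"
    unfolding v0 by (simp_all add: phi_of_def x_of_def y_of_def eta_of_def vec_eq_iff)
  then show "v = 0" by (simp add: v nil_def zero_prod_def)
qed (use linear_0[OF linear_nil] in simp)

text \<open>Along a nonzero line the degrees in t of h and \<open>rho h\<close> are, in the order of
  the cases: 2 and 2; 2 and 4, or 1 and 2 if x = y = 0; 2 and 2; 1 and 2; 4 and 6. The trivial line
  falls under the second case.\<close>

lemma rho_asymp_line:
  fixes S :: "'k::{finite,linorder} coord set"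
  assumes \<nu>: "is_norm \<nu>" and \<nu>': "is_norm \<nu>'" and H: "H = gexp ` S" and S: "S = span {v}"
  shows "rho_asymp \<nu> \<nu>' H 1 \<or> rho_asymp \<nu> \<nu>' H (3/2) \<or> rho_asymp \<nu> \<nu>' H 2"
proof -
  obtain \<phi> x y \<eta> where v: "v = (\<phi>, x, y, \<eta>)" by (cases v)
  have sub: "subspace S" unfolding S by (rule subspace_span)
  have mem: "\<exists>t. \<phi>' = t * \<phi> \<and> x' = t *\<^sub>R x \<and> y' = t *\<^sub>R y \<and> \<eta>' = t * \<eta>"
    if "(\<phi>', x', y', \<eta>') \<in> S" for \<phi>' x' y' \<eta>'
    using that by (auto simp: S v span_singleton)
  consider "\<phi> = 0" "(x \<bullet> x) * (y \<bullet> y) = (x \<bullet> y)\<^sup>2" "x \<noteq> 0 \<or> y \<noteq> 0"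
    | "\<phi> = 0" "(x \<bullet> x) * (y \<bullet> y) = (x \<bullet> y)\<^sup>2 \<Longrightarrow> x = 0 \<and> y = 0"
    | "\<phi> \<noteq> 0" "y = 0" "\<phi> * \<eta> + x \<bullet> x / 2 \<noteq> 0"
    | "\<phi> \<noteq> 0" "y = 0" "\<phi> * \<eta> + x \<bullet> x / 2 = 0"
    | "\<phi> \<noteq> 0" "y \<noteq> 0"
    by blast
  then show ?thesis
  proof cases
    case 1
    have "rho_asymp \<nu> \<nu>' H 1"
    proof (rule rho_asymp_1_phi0[OF \<nu> \<nu>' sub H])
      fix \<phi>' x' y' \<eta>' assume "(\<phi>', x', y', \<eta>') \<in> S"
      from mem[OF this] obtain t where "\<phi>' = t * \<phi>" "x' = t *\<^sub>R x" "y' = t *\<^sub>R y" by blast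
      moreover have "(t * t * (x \<bullet> x)) * (t * t * (y \<bullet> y)) = (t * t * (x \<bullet> y))\<^sup>2"
        using 1(2) by (simp add: power_mult_distrib power2_eq_square)
      ultimately show "\<phi>' = 0 \<and> (x' \<bullet> x') * (y' \<bullet> y') = (x' \<bullet> y')\<^sup>2" using 1(1) by (simp add: mult_ac)
    next
      fix \<eta>' assume "(0, 0, 0, \<eta>') \<in> S"
      from mem[OF this] show "\<eta>' = 0" using 1(3) by auto
    qed
    then show ?thesis ..
  next
    case 2
    have "rho_asymp \<nu> \<nu>' H 2"
    proof (rule rho_asymp_2_phi0[OF \<nu> \<nu>' sub H])
      fix \<phi>' x' y' \<eta>' assume "(\<phi>', x', y', \<eta>') \<in> S"
      from mem[OF this] show "\<phi>' = 0" using 2(1) by auto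
    next
      fix x' y' \<eta>' assume "(0, x', y', \<eta>') \<in> S" and gram: "(x' \<bullet> x') * (y' \<bullet> y') = (x' \<bullet> y')\<^sup>2"
      from mem[OF this(1)] obtain t where t: "x' = t *\<^sub>R x" "y' = t *\<^sub>R y" by blast
      show "x' = 0 \<and> y' = 0"
      proof (cases "t = 0")
        case False
        with gram have "(x \<bullet> x) * (y \<bullet> y) = (x \<bullet> y)\<^sup>2" by (simp add: t power2_eq_square)
        then show ?thesis using 2(2) by (simp add: t)
      qed (simp add: t)
    qed
    then show ?thesis by blast
  next
    case 3
    have "rho_asymp \<nu> \<nu>' H 1"
    proof (rule rho_asymp_1_y0[OF \<nu> \<nu>' sub H])
      fix \<phi>' x' y' \<eta>' assume "(\<phi>', x', y', \<eta>') \<in> S"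
      from mem[OF this] show "y' = 0" using 3(2) by auto
    next
      fix \<phi>' x' \<eta>' assume "(\<phi>', x', 0, \<eta>') \<in> S" and q: "\<phi>' * \<eta>' + x' \<bullet> x' / 2 = 0"
      from mem[OF this(1)] obtain t where t: "\<phi>' = t * \<phi>" "x' = t *\<^sub>R x" "\<eta>' = t * \<eta>" by blast
      have "t * t * (\<phi> * \<eta> + x \<bullet> x / 2) = 0" using q by (simp add: t algebra_simps)
      then show "\<phi>' = 0 \<and> x' = 0 \<and> \<eta>' = 0" using 3(3) by (auto simp: t)
    qed
    then show ?thesis ..
  next
    case 4
    have "rho_asymp \<nu> \<nu>' H 2"
    proof (rule rho_asymp_2_y0[OF \<nu> \<nu>' sub H])
      fix \<phi>' x' y' \<eta>' assume "(\<phi>', x', y', \<eta>') \<in> S"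
      from mem[OF this] obtain t where t: "\<phi>' = t * \<phi>" "x' = t *\<^sub>R x" "y' = t *\<^sub>R y" "\<eta>' = t * \<eta>" by blast
      have "\<phi>' * \<eta>' + x' \<bullet> x' / 2 = t * t * (\<phi> * \<eta> + x \<bullet> x / 2)" by (simp add: t algebra_simps)
      then show "y' = 0 \<and> \<phi>' * \<eta>' + x' \<bullet> x' / 2 = 0" using 4(2,3) by (simp add: t)
    next
      fix x' y' \<eta>' assume "(0, x', y', \<eta>') \<in> S"
      from mem[OF this] show "x' = 0 \<and> \<eta>' = 0" using 4(1) by auto
    qed
    then show ?thesis by blast
  next
    case 5
    then show ?thesis using rho_asymp_3_2[OF \<nu> \<nu>' H S[unfolded v]] by blast
  qed
qed

theorem proposition5p8:
  fixes H :: "'k::{finite,linorder} matrix set"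
    and \<nu> :: "'k matrix \<Rightarrow> real"
    and \<nu>' :: "real ^ 'k wedge_idx ^ 'k wedge_idx \<Rightarrow> real"
  assumes "is_norm \<nu>" and "is_norm \<nu>'"
    and "subgroup H N_group" and "closedin (top_of_set N_set) H" and "connected H"
  shows
    "(dim (lie_algebra H) \<le> 1 \<longrightarrow>
       rho_asymp \<nu> \<nu>' H 1 \<or> rho_asymp \<nu> \<nu>' H (3/2) \<or> rho_asymp \<nu> \<nu>' H 2)
     \<and>
     ((\<forall>A \<in> lie_algebra H. A \<noteq> 0 \<longrightarrow> phi_of A = 0 \<and> dim (span {x_of A, y_of A}) \<noteq> 1) \<longrightarrow>
       rho_asymp \<nu> \<nu>' H 2)
     \<and>
     ((\<forall>A \<in> lie_algebra H. A \<noteq> 0 \<longrightarrow> phi_of A = 0 \<and> dim (span {x_of A, y_of A}) = 1) \<longrightarrow>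
       rho_asymp \<nu> \<nu>' H 1)
     \<and>
     ((\<exists>X\<^sub>0 b c p. subspace X\<^sub>0 \<and> b \<in> X\<^sub>0 \<and> c \<in> orthogonal_comp X\<^sub>0 \<and>
         (norm b)\<^sup>2 - (norm c)\<^sup>2 - 2 * p < 0 \<and>
         (\<forall>A \<in> lie_algebra H.
            y_of A = 0 \<and> (\<exists>z \<in> X\<^sub>0. x_of A = phi_of A *\<^sub>R c + z) \<and>
            eta_of A = p * phi_of A + b \<bullet> x_of A)) \<longrightarrow>
       rho_asymp \<nu> \<nu>' H 1)"
proof -
  note \<nu> = assms(1,2)
  obtain S where S: "subspace S" and H: "H = gexp ` S" and L: "lie_algebra H = nil ` S"
    using connected_subgroup_coords[OF assms(3-5)] .
  have coords: "phi_of (nil (\<phi>, x, y, \<eta>)) = \<phi>" "x_of (nil (\<phi>, x, y, \<eta>)) = x"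
    "y_of (nil (\<phi>, x, y, \<eta>)) = y" "eta_of (nil (\<phi>, x, y, \<eta>)) = \<eta>"
    for \<phi> \<eta> and x y :: "(real, 'k) vec"
    by (simp_all add: nil_def)
  show ?thesis
  proof (intro conjI impI)
    assume "dim (lie_algebra H) \<le> 1"
    moreover have "dim (nil ` S) = dim S"
    proof (rule dim_image_eq[OF linear_nil])
      show "inj_on nil (span S)"
        using linear_nil nil_eq_0 by (metis linear_injective_0 inj_on_subset subset_UNIV)
    qed
    ultimately have "dim S \<le> 1" by (simp add: L)
    then obtain v where "S = span {v}" using dim_le_1_imp_span[OF S] by blast
    then show "rho_asymp \<nu> \<nu>' H 1 \<or> rho_asymp \<nu> \<nu>' H (3/2) \<or> rho_asymp \<nu> \<nu>' H 2"
      by (rule rho_asymp_line[OF \<nu> H])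
  next
    assume A: "\<forall>A \<in> lie_algebra H. A \<noteq> 0 \<longrightarrow> phi_of A = 0 \<and> dim (span {x_of A, y_of A}) \<noteq> 1"
    have P: "\<phi> = 0 \<and> dim (span {x, y}) \<noteq> 1" if "(\<phi>, x, y, \<eta>) \<in> S" "(\<phi>, x, y, \<eta>) \<noteq> 0" for \<phi> x y \<eta>
    proof -
      have "nil (\<phi>, x, y, \<eta>) \<in> lie_algebra H" "nil (\<phi>, x, y, \<eta>) \<noteq> 0"
        using that by (simp_all add: L nil_eq_0)
      then show ?thesis using A[rule_format, of "nil (\<phi>, x, y, \<eta>)"] unfolding coords by blast
    qed
    show "rho_asymp \<nu> \<nu>' H 2"
    proof (rule rho_asymp_2_phi0[OF \<nu> S H])
      fix \<phi> x y \<eta> assume "(\<phi>, x, y, \<eta>) \<in> S"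
      then show "\<phi> = 0" using P[of \<phi> x y \<eta>] by (auto simp: zero_prod_def)
    next
      fix x y \<eta> assume "(0, x, y, \<eta>) \<in> S" "(x \<bullet> x) * (y \<bullet> y) = (x \<bullet> y)\<^sup>2"
      then show "x = 0 \<and> y = 0" using P[of 0 x y \<eta>] unfolding dim_pair_eq_1 by (auto simp: zero_prod_def)
    qed
  next
    assume A: "\<forall>A \<in> lie_algebra H. A \<noteq> 0 \<longrightarrow> phi_of A = 0 \<and> dim (span {x_of A, y_of A}) = 1"
    have P: "\<phi> = 0 \<and> (x \<bullet> x) * (y \<bullet> y) = (x \<bullet> y)\<^sup>2 \<and> (x \<noteq> 0 \<or> y \<noteq> 0)"
      if "(\<phi>, x, y, \<eta>) \<in> S" "(\<phi>, x, y, \<eta>) \<noteq> 0" for \<phi> x y \<eta>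
    proof -
      have "nil (\<phi>, x, y, \<eta>) \<in> lie_algebra H" "nil (\<phi>, x, y, \<eta>) \<noteq> 0"
        using that by (simp_all add: L nil_eq_0)
      then show ?thesis
        using A[rule_format, of "nil (\<phi>, x, y, \<eta>)"] unfolding coords dim_pair_eq_1 by blast
    qed
    show "rho_asymp \<nu> \<nu>' H 1"
    proof (rule rho_asymp_1_phi0[OF \<nu> S H])
      fix \<phi> x y \<eta> assume "(\<phi>, x, y, \<eta>) \<in> S"
      then show "\<phi> = 0 \<and> (x \<bullet> x) * (y \<bullet> y) = (x \<bullet> y)\<^sup>2"
        using P[of \<phi> x y \<eta>] by (cases "(\<phi>, x, y, \<eta>) = 0") (auto simp: zero_prod_def)
    next
      fix \<eta> assume "(0, 0, 0, \<eta>) \<in> S"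
      then show "\<eta> = 0" using P[of 0 0 0 \<eta>] by (auto simp: zero_prod_def)
    qed
  next
    assume "\<exists>X\<^sub>0 b c p. subspace X\<^sub>0 \<and> b \<in> X\<^sub>0 \<and> c \<in> orthogonal_comp X\<^sub>0 \<and>
         (norm b)\<^sup>2 - (norm c)\<^sup>2 - 2 * p < 0 \<and>
         (\<forall>A \<in> lie_algebra H.
            y_of A = 0 \<and> (\<exists>z \<in> X\<^sub>0. x_of A = phi_of A *\<^sub>R c + z) \<and>
            eta_of A = p * phi_of A + b \<bullet> x_of A)"
    then obtain X b c p where b: "b \<in> X" and c: "c \<in> orthogonal_comp X"
      and pos: "b \<bullet> b - c \<bullet> c - 2 * p < 0"
      and A: "\<And>A. A \<in> lie_algebra H \<Longrightarrow> y_of A = 0 \<and> (\<exists>z \<in> X. x_of A = phi_of A *\<^sub>R c + z) \<and>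
            eta_of A = p * phi_of A + b \<bullet> x_of A"
      unfolding power2_norm_eq_inner by blast
    have orth: "z \<bullet> c = 0" "c \<bullet> z = 0" if "z \<in> X" for z
      using c that by (auto simp: orthogonal_comp_def orthogonal_def inner_commute)
    have P: "y = 0 \<and> (\<exists>z\<in>X. x = \<phi> *\<^sub>R c + z) \<and> \<eta> = p * \<phi> + b \<bullet> x" if "(\<phi>, x, y, \<eta>) \<in> S" for \<phi> x y \<eta>
      using A[of "nil (\<phi>, x, y, \<eta>)"] that unfolding L coords by blast
    show "rho_asymp \<nu> \<nu>' H 1"
    proof (rule rho_asymp_1_y0[OF \<nu> S H])
      fix \<phi> x y \<eta> assume "(\<phi>, x, y, \<eta>) \<in> S"
      then show "y = 0" using P by blast
    next
      fix \<phi> x \<eta> assume m: "(\<phi>, x, 0, \<eta>) \<in> S" and q: "\<phi> * \<eta> + x \<bullet> x / 2 = 0"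
      from P[OF m] obtain z where z: "z \<in> X" "x = \<phi> *\<^sub>R c + z" "\<eta> = p * \<phi> + b \<bullet> x" by blast
      \<comment> \<open>Completing the square: as c is orthogonal to b and z, twice the corner form
        is |w|^2 plus phi^2 times |c|^2 + 2p - |b|^2, and the latter factor is positive by
        hypothesis.\<close>
      define w where "w = z + \<phi> *\<^sub>R b"
      have "w \<bullet> w + \<phi>\<^sup>2 * (c \<bullet> c + 2 * p - b \<bullet> b) = 2 * (\<phi> * \<eta> + x \<bullet> x / 2)"
        by (simp add: w_def z(2,3) inner_simps orth[OF b] orth[OF z(1)] power2_eq_square algebra_simps
          inner_commute)
      then have s: "w \<bullet> w + \<phi>\<^sup>2 * (c \<bullet> c + 2 * p - b \<bullet> b) = 0" by (simp add: q)
      have "w \<bullet> w \<ge> 0" "\<phi>\<^sup>2 * (c \<bullet> c + 2 * p - b \<bullet> b) \<ge> 0" using pos by simp_all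
      with s have "w \<bullet> w = 0" "\<phi>\<^sup>2 * (c \<bullet> c + 2 * p - b \<bullet> b) = 0" by linarith+
      then have "\<phi> = 0" "w = 0" using pos by simp_all
      then show "\<phi> = 0 \<and> x = 0 \<and> \<eta> = 0" by (simp add: w_def z(2,3))
    qed
  qed
qed

end
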